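(* (i) Let $G$ be a finite graph and $X,Y\subseteq V(G)$. If there exists a collection $\mathcal P$ of five pairwise vertex-disjoint $X$-$Y$-paths in $G$ such that every vertex in $V(\mathcal P)$ is incident to at most one edge in $E(G)\setminus E(\mathcal P)$, then there exist two non-adjacent $X$-$Y$-paths in $G$. (ii) There exist a finite graph $G$, sets $X,Y\subseteq V(G)$ and a collection $\mathcal P$ of four pairwise vertex-disjoint $X$-$Y$-paths in $G$ such that every vertex in $V(\mathcal P)$ is incident to at most one edge in $E(G)\setminus E(\mathcal P)$, but $G$ does not contain two non-adjacent $X$-$Y$-paths. (iii) There exist a finite graph $G$ of maximum degree three, sets $X,Y\subseteq V(G)$ and a collection of five pairwise vertex-disjoint $X$-$Y$-paths in $G$, but $G$ does not contain two non-adjacent $X$-$Y$-paths.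
   Context: An $X$-$Y$-path is a path with one endpoint in $X$ and the other endpoint in $Y$; a single vertex of $X\cap Y$ counts as an $X$-$Y$-path (of length $0$). For a collection $\mathcal P$ of paths, $V(\mathcal P)=\bigcup_{P\in\mathcal P}V(P)$ and $E(\mathcal P)=\bigcup_{P\in\mathcal P}E(P)$. Two paths are non-adjacent if they are vertex-disjoint and no edge of $G$ joins a vertex of one to a vertex of the other. *)

theory Defs
  imports Main
begin

definition fin_graph :: "'a set \<Rightarrow> 'a set set \<Rightarrow> bool" where
  "fin_graph V E \<longleftrightarrow> finite V \<and> (\<forall>e\<in>E. e \<subseteq> V \<and> card e = 2)"

definition degree :: "'a set set \<Rightarrow> 'a \<Rightarrow> nat" where
  "degree E v = card {e \<in> E. v \<in> e}"

text \<open>Only meaningful for a finite nonempty vertex set.\<close>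
definition max_degree :: "'a set \<Rightarrow> 'a set set \<Rightarrow> nat" where
  "max_degree V E = Max (degree E ` V)"

text \<open>
  A path is given by the list of its vertices in order, so a list and its reversal describe the
  same path. One-element lists are the paths of length \<open>0\<close>.
\<close>
definition path_edges :: "'a list \<Rightarrow> 'a set set" where
  "path_edges p = {{p ! i, p ! Suc i} | i. Suc i < length p}"

definition is_path :: "'a set \<Rightarrow> 'a set set \<Rightarrow> 'a list \<Rightarrow> bool" where
  "is_path V E p \<longleftrightarrow> p \<noteq> [] \<and> distinct p \<and> set p \<subseteq> V \<and> path_edges p \<subseteq> E"

text \<open>Inner vertices of the path are allowed to lie in \<open>X \<union> Y\<close>.\<close>
definition XY_path :: "'a set \<Rightarrow> 'a set set \<Rightarrow> 'a set \<Rightarrow> 'a set \<Rightarrow> 'a list \<Rightarrow> bool" where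
  "XY_path V E X Y p \<longleftrightarrow> is_path V E p \<and>
     (hd p \<in> X \<and> last p \<in> Y \<or> hd p \<in> Y \<and> last p \<in> X)"

definition disjoint_XY_paths ::
    "'a set \<Rightarrow> 'a set set \<Rightarrow> 'a set \<Rightarrow> 'a set \<Rightarrow> nat \<Rightarrow> 'a list set \<Rightarrow> bool" where
  "disjoint_XY_paths V E X Y k \<P> \<longleftrightarrow>
     finite \<P> \<and> card \<P> = k \<and> (\<forall>p\<in>\<P>. XY_path V E X Y p) \<and>
     (\<forall>p\<in>\<P>. \<forall>q\<in>\<P>. p \<noteq> q \<longrightarrow> set p \<inter> set q = {})"

definition paths_verts :: "'a list set \<Rightarrow> 'a set" where
  "paths_verts \<P> = (\<Union>p\<in>\<P>. set p)"

definition paths_edges :: "'a list set \<Rightarrow> 'a set set" where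
  "paths_edges \<P> = (\<Union>p\<in>\<P>. path_edges p)"

definition non_adjacent :: "'a set set \<Rightarrow> 'a list \<Rightarrow> 'a list \<Rightarrow> bool" where
  "non_adjacent E p q \<longleftrightarrow> set p \<inter> set q = {} \<and> (\<forall>u\<in>set p. \<forall>v\<in>set q. {u, v} \<notin> E)"

end

theory Submission
  imports Defs
begin

text \<open>
  (i) Orient the five paths (``lines'') from \<open>X\<close> to \<open>Y\<close> and choose them with minimal total length
  among all linkages inside their vertex set whose remaining edges (``chords'') form a matching. Sweep
  a cut, given by one initial segment of every line and closed under the matching, from \<open>X\<close> to \<open>Y\<close>.
  Minimality leaves three ways to advance it: past one unmatched vertex, past two matched vertices
  (a rung), or, for some non-identical permutation \<open>s\<close> of the lines, past two vertices on every moved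
  line \<open>i\<close>, the first of which is matched to the second one of line \<open>s i\<close> (a twist); any other cyclic
  arrangement of chords would allow to reroute the lines along \<open>s\<close> into a shorter linkage.

  While sweeping, keep track of all pairs of lines \<open>a\<close>, \<open>b\<close> to which two non-adjacent partial paths
  lead, together with the set \<open>H\<close> of further lines whose last vertex before the cut may be occupied.
  Up to relabelling the lines, the set of realized states \<open>(a, b, H)\<close> always contains one of 24
  patterns, which is a finite check; so two non-adjacent paths survive to the end.

  (ii) A sequence of 16 rungs on four lines defeats every pair of paths. (iii) In the Petersen graph,
  with \<open>X\<close> the outer and \<open>Y\<close> the inner cycle, every path uses one of the pairwise adjacent spokes. Both
  are verified by the same search: extend a path from \<open>X\<close> until its closed neighbourhood separates
  \<open>X\<close> from \<open>Y\<close>.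
\<close>

section \<open>Rerouting linkages\<close>

lemma path_edges_Nil [simp]: "path_edges [] = {}"
  by (simp add: path_edges_def)

lemma path_edges_singleton [simp]: "path_edges [x] = {}"
  by (simp add: path_edges_def)

lemma path_edges_Cons_Cons [simp]:
  "path_edges (x # y # zs) = insert {x, y} (path_edges (y # zs))"
proof -
  have "{{(x # y # zs) ! i, (x # y # zs) ! Suc i} | i. Suc i < length (x # y # zs)} =
        insert {x, y} {{(y # zs) ! i, (y # zs) ! Suc i} | i. Suc i < length (y # zs)}"
    (is "?L = ?R")
  proof
    show "?L \<subseteq> ?R"
    proof
      fix e assume "e \<in> ?L"
      then obtain i where i: "e = {(x # y # zs) ! i, (x # y # zs) ! Suc i}" "Suc i < length (x # y # zs)"
        by blast
      show "e \<in> ?R"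
      proof (cases i)
        case 0
        then show ?thesis using i by simp
      next
        case (Suc j)
        then have "e = {(y # zs) ! j, (y # zs) ! Suc j}" "Suc j < length (y # zs)" using i by auto
        then show ?thesis by blast
      qed
    qed
    show "?R \<subseteq> ?L"
    proof
      fix e assume "e \<in> ?R"
      then consider "e = {x, y}" | i where "e = {(y # zs) ! i, (y # zs) ! Suc i}" "Suc i < length (y # zs)"
        by blast
      then show "e \<in> ?L"
      proof cases
        case 1
        then show ?thesis by (intro CollectI exI[of _ 0]) simp
      next
        case 2
        then show ?thesis by (intro CollectI exI[of _ "Suc i"]) simp
      qed
    qed
  qed
  then show ?thesis by (simp add: path_edges_def)
qed

lemma path_edges_append:
  "path_edges (xs @ ys) = path_edges xs \<union> path_edges ys \<union>
     (if xs = [] \<or> ys = [] then {} else {{last xs, hd ys}})"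
proof (induction xs)
  case Nil
  then show ?case by simp
next
  case (Cons x xs)
  then show ?case by (cases xs; cases ys) (simp_all add: Un_ac)
qed

lemma path_edges_rev [simp]: "path_edges (rev xs) = path_edges xs"
proof (induction xs)
  case Nil
  then show ?case by simp
next
  case (Cons x xs)
  have "path_edges (rev (x # xs)) = path_edges xs \<union> (if xs = [] then {} else {{hd xs, x}})"
    by (simp add: path_edges_append Cons.IH last_rev)
  then show ?case by (cases xs) (simp_all add: insert_commute)
qed

lemma path_edges_take: "path_edges (take n xs) \<subseteq> path_edges xs"
  using path_edges_append[of "take n xs" "drop n xs"] by auto

lemma path_edges_drop: "path_edges (drop n xs) \<subseteq> path_edges xs"
  using path_edges_append[of "take n xs" "drop n xs"] by auto

lemma in_set_drop_conv_nth: "x \<in> set (drop n xs) \<longleftrightarrow> (\<exists>k\<ge>n. k < length xs \<and> x = xs ! k)"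
proof
  assume "x \<in> set (drop n xs)"
  then obtain k where "k < length (drop n xs)" "x = drop n xs ! k" by (metis in_set_conv_nth)
  then show "\<exists>k\<ge>n. k < length xs \<and> x = xs ! k" by (intro exI[of _ "n + k"]) auto
next
  assume "\<exists>k\<ge>n. k < length xs \<and> x = xs ! k"
  then obtain k where "n \<le> k" "k < length xs" "x = xs ! k" by blast
  then have "k - n < length (drop n xs)" "x = drop n xs ! (k - n)" by auto
  then show "x \<in> set (drop n xs)" using nth_mem by blast
qed

lemma edge_in_path_edges_take:
  "Suc k < n \<Longrightarrow> Suc k < length xs \<Longrightarrow> {xs ! k, xs ! Suc k} \<in> path_edges (take n xs)"
  unfolding path_edges_def by (auto intro!: exI[of _ k])

lemma edge_in_path_edges_drop:
  assumes "n \<le> k" "Suc k < length xs"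
  shows "{xs ! k, xs ! Suc k} \<in> path_edges (drop n xs)"
  unfolding path_edges_def using assms by (intro CollectI exI[of _ "k - n"]) auto

section \<open>Linkages, their chords, and crossing over along chords\<close>

definition linkage :: "'a set \<Rightarrow> 'a set set \<Rightarrow> 'a set \<Rightarrow> 'a set \<Rightarrow> ('l \<Rightarrow> 'a list) \<Rightarrow> bool" where
  "linkage V E X Y p \<longleftrightarrow>
     (\<forall>i. is_path V E (p i) \<and> hd (p i) \<in> X \<and> last (p i) \<in> Y) \<and>
     (\<forall>i j. i \<noteq> j \<longrightarrow> set (p i) \<inter> set (p j) = {})"

definition chord :: "'a set set \<Rightarrow> ('l \<Rightarrow> 'a list) \<Rightarrow> 'a \<Rightarrow> 'a \<Rightarrow> bool" where
  "chord E p u v \<longleftrightarrow> {u, v} \<in> E \<and> u \<in> (\<Union>i. set (p i)) \<and> v \<in> (\<Union>i. set (p i)) \<and>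
     {u, v} \<notin> (\<Union>i. path_edges (p i))"

text \<open>The form in which the degree bound of (i) enters. Only edges inside the vertex set of
  the linkage matter, since all paths built later stay in that set.\<close>

definition chords_matching :: "'a set set \<Rightarrow> ('l \<Rightarrow> 'a list) \<Rightarrow> bool" where
  "chords_matching E p \<longleftrightarrow> (\<forall>u v w. chord E p u v \<longrightarrow> chord E p u w \<longrightarrow> v = w)"

lemma chord_sym: "chord E p u v \<Longrightarrow> chord E p v u"
  by (auto simp: chord_def insert_commute)

lemma linkage_nth_eq_iff:
  assumes "linkage V E X Y p" "k < length (p i)" "l < length (p j)"
  shows "p i ! k = p j ! l \<longleftrightarrow> i = j \<and> k = l"
proof (cases "i = j")
  case True
  then show ?thesis using assms by (auto simp: linkage_def is_path_def nth_eq_iff_index_eq)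
next
  case False
  then have "set (p i) \<inter> set (p j) = {}" using assms by (auto simp: linkage_def)
  then show ?thesis using False assms(2,3) nth_mem by (metis disjoint_iff)
qed

text \<open>On every line of \<open>C\<close> the segment up to position \<open>c i\<close> and the
  segment from \<open>d i\<close> on are disjoint, so crossing over along the chords prescribed by
  \<open>s\<close> gives disjoint paths again. The matching survives because a junction vertex
  trades its old chord, now a path edge, for at most the line edge that has been given up.\<close>

lemma linkage_reroute:
  fixes p :: "'l \<Rightarrow> 'a list"
  assumes lk: "linkage V E X Y p" and m: "chords_matching E p" and s: "bij_betw s C C"
    and cd: "\<And>i. i \<in> C \<Longrightarrow> c i < d i \<and> d i < length (p i)"
    and ch: "\<And>i. i \<in> C \<Longrightarrow> chord E p (p i ! c i) (p (s i) ! d (s i))"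
  defines "q \<equiv> \<lambda>i. if i \<in> C then take (Suc (c i)) (p i) @ drop (d (s i)) (p (s i)) else p i"
  shows "linkage V E X Y q" and "chords_matching E q"
proof -
  have sC: "s i \<in> C" if "i \<in> C" for i using s that by (auto simp: bij_betw_def)
  have s_inj: "i = j" if "i \<in> C" "j \<in> C" "s i = s j" for i j
    using s that by (auto simp: bij_betw_def inj_on_def)
  have s_surj: "\<exists>i\<in>C. s i = j" if "j \<in> C" for j
    using s that unfolding bij_betw_def by (metis imageE)
  have path: "is_path V E (p i)" and dist: "distinct (p i)" and hdX: "hd (p i) \<in> X" and lastY: "last (p i) \<in> Y" for i
    using lk by (auto simp: linkage_def is_path_def)
  have disj: "set (p i) \<inter> set (p j) = {}" if "i \<noteq> j" for i j using lk that by (auto simp: linkage_def)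
  have q_in: "q i = take (Suc (c i)) (p i) @ drop (d (s i)) (p (s i))" if "i \<in> C" for i
    using that by (simp add: q_def)
  have q_out: "q i = p i" if "i \<notin> C" for i using that by (simp add: q_def)
  have ne: "take (Suc (c i)) (p i) \<noteq> []" "drop (d (s i)) (p (s i)) \<noteq> []" 
    and hdd: "hd (drop (d (s i)) (p (s i))) = p (s i) ! d (s i)"
    and lst: "last (take (Suc (c i)) (p i)) = p i ! c i" if "i \<in> C" for i
    using cd[OF that] cd[OF sC[OF that]]
    by (auto simp: hd_drop_conv_nth take_Suc_conv_app_nth[of "c i" "p i"])
  have take_drop: "set (take (Suc (c i)) (p i)) \<inter> set (drop (d j) (p j)) = {}" if "i \<in> C" "j \<in> C" for i j
  proof (cases "i = j")
    case True
    then show ?thesis using set_take_disj_set_drop_if_distinct[OF dist, of "Suc (c i)" "d i"] cd[OF that(1)] by auto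
  next
    case False
    then show ?thesis using disj[OF False] set_take_subset set_drop_subset by fastforce
  qed
  have edges_q: "path_edges (q i) = path_edges (take (Suc (c i)) (p i)) \<union> path_edges (drop (d (s i)) (p (s i)))
      \<union> {{p i ! c i, p (s i) ! d (s i)}}" if "i \<in> C" for i
    using that ne[OF that] hdd[OF that] lst[OF that] by (auto simp: q_in path_edges_append)
  show lq: "linkage V E X Y q"
    unfolding linkage_def
  proof (intro conjI allI impI)
    fix i
    show "is_path V E (q i)"
    proof (cases "i \<in> C")
      case True
      have "path_edges (q i) \<subseteq> E"
        using edges_q[OF True] path[of i] path[of "s i"] path_edges_take[of "Suc (c i)" "p i"]
          path_edges_drop[of "d (s i)" "p (s i)"] ch[OF True] by (auto simp: is_path_def chord_def)
      moreover have "set (q i) \<subseteq> V"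
        using path[of i] path[of "s i"] True set_take_subset[of "Suc (c i)" "p i"]
          set_drop_subset[of "d (s i)" "p (s i)"] by (auto simp: q_in is_path_def)
      moreover have "distinct (q i)"
        using True take_drop[OF True sC[OF True]] dist by (auto simp: q_in)
      ultimately show ?thesis using ne(1)[OF True] True by (simp add: is_path_def q_in)
    qed (simp add: q_out path)
    show "hd (q i) \<in> X"
      using hdX ne(1) by (cases "i \<in> C") (auto simp: q_in q_out)
    show "last (q i) \<in> Y"
      using lastY ne(2)[of i] last_drop[of "d (s i)" "p (s i)"] by (cases "i \<in> C") (auto simp: q_in q_out)
  next
    fix i j :: 'l assume "i \<noteq> j"
    have tt: "set (take a (p i)) \<inter> set (take b (p j)) = {}" for a b
      using disj[OF \<open>i \<noteq> j\<close>] by (meson disjoint_iff in_set_takeD)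
    have dd: "set (drop a (p (s i))) \<inter> set (drop b (p (s j))) = {}" if "i \<in> C" "j \<in> C" for a b
      using disj[of "s i" "s j"] s_inj[OF that] \<open>i \<noteq> j\<close> by (meson disjoint_iff in_set_dropD)
    have td: "set (take a (p i)) \<inter> set (p j) = {}" "set (p i) \<inter> set (take a (p j)) = {}" for a
      using disj[OF \<open>i \<noteq> j\<close>] by (meson disjoint_iff in_set_takeD)+
    have dC: "set (drop a (p (s k))) \<inter> set (p l) = {}" if "k \<in> C" "l \<notin> C" for a k l
    proof -
      have "s k \<noteq> l" using that sC by auto
      then show ?thesis using disj by (meson disjoint_iff in_set_dropD)
    qed
    show "set (q i) \<inter> set (q j) = {}"
    proof (cases "i \<in> C")
      case iC: True
      show ?thesis
      proof (cases "j \<in> C")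
        case True
        then show ?thesis using iC tt dd[OF iC True] take_drop[OF iC sC[OF True]] take_drop[OF True sC[OF iC]]
          by (simp add: q_in Int_Un_distrib Int_Un_distrib2 Int_commute)
      next
        case False
        then show ?thesis using iC td dC[OF iC False] by (simp add: q_in q_out Int_Un_distrib2)
      qed
    next
      case iC: False
      show ?thesis
      proof (cases "j \<in> C")
        case True
        then show ?thesis using iC td dC[OF True iC] by (simp add: q_in q_out Int_Un_distrib Int_commute)
      next
        case False
        then show ?thesis using iC disj[OF \<open>i \<noteq> j\<close>] by (simp add: q_out)
      qed
    qed
  qed
  have Uq: "u \<in> (\<Union>i. set (p i))" if u: "u \<in> (\<Union>i. set (q i))" for u
  proof -
    obtain i where "u \<in> set (q i)" using u by blast
    then show ?thesis by (cases "i \<in> C") (auto simp: q_in q_out dest: in_set_takeD in_set_dropD)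
  qed
  have not_Uq: "k \<le> c j \<or> d j \<le> k" if jk: "p j ! k \<in> (\<Union>i. set (q i))" "j \<in> C" "k < length (p j)" for j k
  proof -
    obtain i where i: "p j ! k \<in> set (q i)" using jk(1) by blast
    show ?thesis
    proof (cases "i \<in> C")
      case True
      then consider "p j ! k \<in> set (take (Suc (c i)) (p i))" | "p j ! k \<in> set (drop (d (s i)) (p (s i)))"
        using i by (auto simp: q_in)
      then show ?thesis
      proof cases
        case 1
        then obtain l where "l < length (p i)" "l < Suc (c i)" "p j ! k = p i ! l"
          by (auto simp: in_set_conv_nth)
        then show ?thesis using linkage_nth_eq_iff[OF lk jk(3)] by auto
      next
        case 2
        then obtain l where "l < length (p (s i))" "d (s i) \<le> l" "p j ! k = p (s i) ! l"
          by (auto simp: in_set_drop_conv_nth)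
        then show ?thesis using linkage_nth_eq_iff[OF lk jk(3)] by auto
      qed
    next
      case False
      then have "i \<noteq> j" using jk by auto
      then show ?thesis using i disj jk(3) False nth_mem by (metis disjoint_iff q_out)
    qed
  qed
  \<comment> \<open>A line edge of \<open>p\<close> that turns into a chord of \<open>q\<close>
    still has both ends on \<open>q\<close>. The vertices strictly between \<open>c j\<close> and
    \<open>d j\<close> are gone, so such an edge must bridge a gap without inner vertices.\<close>
  have new_chord: "chord E p u v \<or> (\<exists>j\<in>C. d j = Suc (c j) \<and> {u, v} = {p j ! c j, p j ! d j})"
    if "chord E q u v" for u v
  proof (rule disjCI)
    assume no: "\<not> (\<exists>j\<in>C. d j = Suc (c j) \<and> {u, v} = {p j ! c j, p j ! d j})"
    have uv: "{u, v} \<in> E" "u \<in> (\<Union>i. set (q i))" "v \<in> (\<Union>i. set (q i))" "{u, v} \<notin> (\<Union>i. path_edges (q i))"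
      using that by (auto simp: chord_def)
    have "{u, v} \<notin> path_edges (p j)" for j
    proof
      assume "{u, v} \<in> path_edges (p j)"
      then obtain k where k: "{u, v} = {p j ! k, p j ! Suc k}" "Suc k < length (p j)"
        by (auto simp: path_edges_def)
      have inq: "p j ! k \<in> (\<Union>i. set (q i))" "p j ! Suc k \<in> (\<Union>i. set (q i))"
        using uv(2,3) k(1) unfolding doubleton_eq_iff by auto
      show False
      proof (cases "j \<in> C")
        case True
        obtain i where i: "i \<in> C" "s i = j" using s_surj[OF True] by blast
        have "\<not> Suc k \<le> c j"
          using edge_in_path_edges_take[of k "Suc (c j)" "p j"] k uv(4) edges_q[OF True] by auto
        moreover have "\<not> d j \<le> k"
          using edge_in_path_edges_drop[of "d j" k "p j"] k uv(4) edges_q[OF i(1)] i(2) by auto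
        ultimately have "k = c j" "Suc k = d j"
          using not_Uq[OF inq(1) True] not_Uq[OF inq(2) True] k(2) by auto
        then show False using no True k(1) by metis
      next
        case False
        then have "{u, v} \<in> path_edges (q j)" using \<open>{u, v} \<in> path_edges (p j)\<close> by (simp add: q_out)
        then show False using uv(4) by blast
      qed
    qed
    then show "chord E p u v" using uv Uq by (auto simp: chord_def)
  qed
  \<comment> \<open>The old chord at a junction vertex is now an edge of \<open>q\<close>, and the
    matching allows no second old chord there.\<close>
  have junction: "\<exists>j\<in>C. d j = Suc (c j) \<and> {u, v} = {p j ! c j, p j ! d j}"
    if uv: "chord E q u v" and i: "i \<in> C" "u = p i ! c i \<or> u = p i ! d i" for u v i
  proof -
    obtain k where k: "k \<in> C" "u = p k ! c k \<and> k = i \<or> u = p (s k) ! d (s k) \<and> s k = i"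
      using i s_surj by blast
    have "\<not> chord E p u v"
    proof
      assume c: "chord E p u v"
      have "{u, v} = {p k ! c k, p (s k) ! d (s k)}"
        using k(2)
      proof
        assume a: "u = p k ! c k \<and> k = i"
        then have "v = p (s k) ! d (s k)" using c ch[OF k(1)] m unfolding chords_matching_def by blast
        then show ?thesis using a by simp
      next
        assume a: "u = p (s k) ! d (s k) \<and> s k = i"
        then have "v = p k ! c k" using c chord_sym[OF ch[OF k(1)]] m unfolding chords_matching_def by blast
        then show ?thesis using a by (simp add: insert_commute)
      qed
      then have "{u, v} \<in> path_edges (q k)" using edges_q[OF k(1)] by simp
      then show False using uv by (auto simp: chord_def)
    qed
    then show ?thesis using new_chord[OF uv] by blast
  qed
  show "chords_matching E q"
    unfolding chords_matching_def
  proof (intro allI impI)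
    fix u v w assume uv: "chord E q u v" and uw: "chord E q u w"
    show "v = w"
    proof (cases "\<exists>i\<in>C. u = p i ! c i \<or> u = p i ! d i")
      case True
      then obtain i where i: "i \<in> C" "u = p i ! c i \<or> u = p i ! d i" by blast
      obtain j where j: "j \<in> C" "{u, v} = {p j ! c j, p j ! d j}" using junction[OF uv i] by blast
      obtain k where k: "k \<in> C" "{u, w} = {p k ! c k, p k ! d k}" using junction[OF uw i] by blast
      have lens: "c j < length (p j)" "d j < length (p j)" "c k < length (p k)" "d k < length (p k)"
        "c j \<noteq> d j" "c k \<noteq> d k"
        using cd[OF j(1)] cd[OF k(1)] by auto
      note eqs = linkage_nth_eq_iff[OF lk lens(1) lens(3)] linkage_nth_eq_iff[OF lk lens(1) lens(4)]
        linkage_nth_eq_iff[OF lk lens(2) lens(3)] linkage_nth_eq_iff[OF lk lens(2) lens(4)]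
      show ?thesis using j(2) k(2) eqs lens(5,6) unfolding doubleton_eq_iff by metis
    next
      case False
      then have "chord E p u v" "chord E p u w"
        using new_chord[OF uv] new_chord[OF uw] by (auto simp: doubleton_eq_iff)
      then show ?thesis using m unfolding chords_matching_def by blast
    qed
  qed
qed

section \<open>Linkages of minimal total length\<close>

definition tight :: "'a set set \<Rightarrow> ('l \<Rightarrow> 'a list) \<Rightarrow> bool" where
  "tight E p \<longleftrightarrow> (\<forall>C s c d. bij_betw s C C \<longrightarrow> (\<forall>i\<in>C. c i < d i \<and> d i < length (p i)) \<longrightarrow>
     (\<forall>i\<in>C. chord E p (p i ! c i) (p (s i) ! d (s i))) \<longrightarrow> (\<forall>i\<in>C. d i = Suc (c i)))"

text \<open>A linkage of least total length is tight: the rerouted one is again a candidate, and it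
  is shorter as soon as one \<open>d i\<close> exceeds \<open>Suc (c i)\<close>.\<close>

lemma ex_tight_linkage:
  fixes p :: "'l :: finite \<Rightarrow> 'a list"
  assumes "linkage V E X Y p" "chords_matching E p"
  shows "\<exists>q :: 'l \<Rightarrow> 'a list. linkage V E X Y q \<and> chords_matching E q \<and> tight E q"
proof -
  let ?P = "\<lambda>q :: 'l \<Rightarrow> 'a list. linkage V E X Y q \<and> chords_matching E q"
  let ?m = "\<lambda>q :: 'l \<Rightarrow> 'a list. \<Sum>i\<in>UNIV. length (q i)"
  obtain p where p: "?P p" and min: "\<And>q. ?P q \<Longrightarrow> ?m p \<le> ?m q"
    using ex_has_least_nat[of ?P _ ?m] assms by blast
  have "tight E p"
    unfolding tight_def
  proof (intro allI impI)
    fix C :: "'l set" and s c d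
    assume s: "bij_betw s C C" and cd: "\<forall>i\<in>C. c i < d i \<and> d i < length (p i)"
      and ch: "\<forall>i\<in>C. chord E p (p i ! c i) (p (s i) ! d (s i))"
    have sC: "s i \<in> C" if "i \<in> C" for i using s that by (auto simp: bij_betw_def)
    define q where "q = (\<lambda>i. if i \<in> C then take (Suc (c i)) (p i) @ drop (d (s i)) (p (s i)) else p i)"
    have "?P q" unfolding q_def using linkage_reroute[of V E X Y p s C c d] p s cd ch by auto
    then have "?m p \<le> ?m q" by (rule min)
    have split: "?m r = (\<Sum>i\<in>C. length (r i)) + (\<Sum>i\<in>-C. length (r i))" for r :: "'l \<Rightarrow> 'a list"
      by (metis (no_types, lifting) sum.subset_diff finite subset_UNIV Compl_eq_Diff_UNIV add.commute)
    have "(\<Sum>i\<in>-C. length (q i)) = (\<Sum>i\<in>-C. length (p i))" by (rule sum.cong) (auto simp: q_def)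
    then have le: "(\<Sum>i\<in>C. length (p i)) \<le> (\<Sum>i\<in>C. length (q i))"
      using \<open>?m p \<le> ?m q\<close> split[of p] split[of q] by simp
    have "(\<Sum>i\<in>C. length (q i)) = (\<Sum>i\<in>C. Suc (c i) + (length (p (s i)) - d (s i)))"
      by (rule sum.cong) (use cd in \<open>auto simp: q_def min_def\<close>)
    also have "\<dots> = (\<Sum>i\<in>C. Suc (c i)) + (\<Sum>i\<in>C. length (p (s i)) - d (s i))"
      by (rule sum.distrib)
    \<comment> \<open>Each final segment is used exactly once, so the sum can be reindexed along
      \<open>s\<close>.\<close>
    also have "(\<Sum>i\<in>C. length (p (s i)) - d (s i)) = (\<Sum>i\<in>C. length (p i) - d i)"
      using sum.reindex_bij_betw[OF s, of "\<lambda>i. length (p i) - d i"] .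
    finally have "(\<Sum>i\<in>C. length (q i)) = (\<Sum>i\<in>C. Suc (c i) + (length (p i) - d i))"
      by (simp only: sum.distrib)
    then have *: "\<not> (\<Sum>i\<in>C. Suc (c i) + (length (p i) - d i)) < (\<Sum>i\<in>C. length (p i))"
      using le by simp
    show "\<forall>i\<in>C. d i = Suc (c i)"
    proof (rule ccontr)
      assume "\<not> (\<forall>i\<in>C. d i = Suc (c i))"
      then obtain i where i: "i \<in> C" "d i \<noteq> Suc (c i)" by blast
      have "(\<Sum>i\<in>C. Suc (c i) + (length (p i) - d i)) < (\<Sum>i\<in>C. length (p i))"
      proof (rule sum_strict_mono_ex1)
        show "\<forall>i\<in>C. Suc (c i) + (length (p i) - d i) \<le> length (p i)" using cd by fastforce
        have "Suc (c i) + (length (p i) - d i) < length (p i)" using cd i by fastforce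
        then show "\<exists>i\<in>C. Suc (c i) + (length (p i) - d i) < length (p i)" using i(1) by blast
      qed simp
      then show False using * by contradiction
    qed
  qed
  then show ?thesis using p by blast
qed

text \<open>A nonempty invariant subset of least size is mapped onto itself, since its image is
  invariant too. In \<open>next_event\<close> this finds a cyclic arrangement of chords.\<close>

lemma ex_closed_subset_bij_betw:
  assumes "finite A" "A \<noteq> {}" "f ` A \<subseteq> A"
  shows "\<exists>C\<subseteq>A. C \<noteq> {} \<and> bij_betw f C C"
proof -
  let ?Q = "\<lambda>C. C \<subseteq> A \<and> C \<noteq> {} \<and> f ` C \<subseteq> C"
  obtain C where C: "?Q C" and min: "\<And>D. ?Q D \<Longrightarrow> card C \<le> card D"
    using ex_has_least_nat[of ?Q A card] assms by blast
  have fin: "finite C" using C assms(1) finite_subset by blast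
  have "?Q (f ` C)" using C by auto
  then have "card C \<le> card (f ` C)" by (rule min)
  then have "f ` C = C" using C fin by (simp add: card_seteq)
  moreover have "inj_on f C" using fin calculation by (simp add: eq_card_imp_inj_on)
  ultimately show ?thesis using C by (auto simp: bij_betw_def)
qed

section \<open>Cuts and the events that advance them\<close>

locale tight_linkage =
  fixes V :: "'a set" and E :: "'a set set" and X Y :: "'a set" and p :: "'l :: finite \<Rightarrow> 'a list"
  assumes no_loop: "{v} \<notin> E"
    and linkage: "linkage V E X Y p"
    and matching: "chords_matching E p"
    and tight: "tight E p"
begin

text \<open>\<open>c i\<close> is the number of vertices of line \<open>i\<close> before the cut, so
  \<open>p i ! c i\<close> is the first vertex beyond it. The second condition forbids chords across
  the cut.\<close>

definition cut :: "('l \<Rightarrow> nat) \<Rightarrow> bool" where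
  "cut c \<longleftrightarrow> (\<forall>i. c i \<le> length (p i)) \<and>
     (\<forall>i j k l. k < c i \<longrightarrow> l < length (p j) \<longrightarrow> chord E p (p i ! k) (p j ! l) \<longrightarrow> l < c j)"

lemma nth_eq_iff: "k < length (p i) \<Longrightarrow> l < length (p j) \<Longrightarrow> p i ! k = p j ! l \<longleftrightarrow> i = j \<and> k = l"
  using linkage_nth_eq_iff[OF linkage] .

lemma chord_unique: "chord E p u v \<Longrightarrow> chord E p u w \<Longrightarrow> v = w"
  using matching unfolding chords_matching_def by blast

lemma not_chord_consecutive: "Suc k < length (p i) \<Longrightarrow> \<not> chord E p (p i ! k) (p i ! Suc k)"
  unfolding chord_def path_edges_def by blast

lemma chord_position:
  assumes "chord E p u v"
  obtains j l where "l < length (p j)" "v = p j ! l"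
  using assms unfolding chord_def by (metis UN_E in_set_conv_nth)

lemma path_nonempty: "p i \<noteq> []"
  using linkage unfolding linkage_def is_path_def by blast

lemma path_in: "k < length (p i) \<Longrightarrow> p i ! k \<in> V"
  using linkage nth_mem unfolding linkage_def is_path_def by blast

lemma path_edge: "Suc k < length (p i) \<Longrightarrow> {p i ! k, p i ! Suc k} \<in> E"
  using linkage unfolding linkage_def is_path_def path_edges_def by blast

lemma path_hd: "p i ! 0 \<in> X"
  using linkage path_nonempty[of i] hd_conv_nth[of "p i"] unfolding linkage_def by metis

lemma path_last: "p i ! (length (p i) - 1) \<in> Y"
  using linkage path_nonempty[of i] last_conv_nth[of "p i"] unfolding linkage_def by metis

lemma edge_cases:
  assumes "{p i ! k, p j ! l} \<in> E" "k < length (p i)" "l < length (p j)"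
  shows "chord E p (p i ! k) (p j ! l) \<or> i = j \<and> (k = Suc l \<or> l = Suc k)"
proof (rule disjCI)
  assume not: "\<not> (i = j \<and> (k = Suc l \<or> l = Suc k))"
  show "chord E p (p i ! k) (p j ! l)"
  proof (rule ccontr)
    assume "\<not> chord E p (p i ! k) (p j ! l)"
    then obtain h where "{p i ! k, p j ! l} \<in> path_edges (p h)"
      using assms nth_mem[OF assms(2)] nth_mem[OF assms(3)] unfolding chord_def by blast
    then obtain n where n: "{p i ! k, p j ! l} = {p h ! n, p h ! Suc n}" "Suc n < length (p h)"
      by (auto simp: path_edges_def)
    have n': "n < length (p h)" using n(2) by simp
    have "i = h \<and> k = n \<and> j = h \<and> l = Suc n \<or> i = h \<and> k = Suc n \<and> j = h \<and> l = n"
      using n(1) nth_eq_iff[OF assms(2) n'] nth_eq_iff[OF assms(2) n(2)]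
        nth_eq_iff[OF assms(3) n'] nth_eq_iff[OF assms(3) n(2)] unfolding doubleton_eq_iff by auto
    then show False using not by auto
  qed
qed

text \<open>If the first two events are impossible, the first vertex beyond the cut on each
  unfinished line has a chord to a vertex strictly further along some line. Following these chords
  maps the unfinished lines to themselves; on a subset that is permuted, tightness forces every
  chord to arrive just one position further, which is a twist.\<close>

lemma next_event:
  assumes c: "cut c" and unfinished: "c i0 < length (p i0)"
  obtains (single) i where "c i < length (p i)" "\<And>v. \<not> chord E p (p i ! c i) v"
  | (rung) i j where "i \<noteq> j" "c i < length (p i)" "c j < length (p j)" "chord E p (p i ! c i) (p j ! c j)"
  | (twist) s where "bij s" "s \<noteq> id"
      "\<And>i. s i \<noteq> i \<Longrightarrow> Suc (c i) < length (p i) \<and> chord E p (p i ! c i) (p (s i) ! Suc (c (s i)))"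
proof -
  let ?A = "{i. c i < length (p i)}"
  show thesis
  proof (cases "(\<exists>i\<in>?A. \<forall>v. \<not> chord E p (p i ! c i) v) \<or>
      (\<exists>i\<in>?A. \<exists>j\<in>?A. i \<noteq> j \<and> chord E p (p i ! c i) (p j ! c j))")
    case True
    then show thesis using single rung by blast
  next
    case False
    \<comment> \<open>The partner is not before the cut, which no chord crosses, and not the first
      vertex beyond it, which would give a loop or a rung.\<close>
    have "\<exists>j l. c j < l \<and> l < length (p j) \<and> chord E p (p i ! c i) (p j ! l)" if i: "i \<in> ?A" for i
    proof -
      obtain v where v: "chord E p (p i ! c i) v" using False i by blast
      obtain j l where jl: "l < length (p j)" "v = p j ! l" by (rule chord_position[OF v])
      have "\<not> l < c j"
      proof
        assume "l < c j"
        then have "c i < c i" using c i chord_sym[OF v] jl unfolding cut_def by blast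
        then show False by simp
      qed
      moreover have "l \<noteq> c j"
      proof
        assume "l = c j"
        moreover have "i \<noteq> j" using v no_loop[of v] jl(2) \<open>l = c j\<close> by (auto simp: chord_def)
        ultimately show False using False i v jl by auto
      qed
      ultimately show ?thesis using v jl by (metis linorder_neqE_nat)
    qed
    then obtain f e where fe: "\<And>i. i \<in> ?A \<Longrightarrow> c (f i) < e i \<and> e i < length (p (f i)) \<and>
        chord E p (p i ! c i) (p (f i) ! e i)"
      by metis
    have "f ` ?A \<subseteq> ?A" using fe by fastforce
    then obtain C where C: "C \<subseteq> ?A" "C \<noteq> {}" "bij_betw f C C"
      using ex_closed_subset_bij_betw[of ?A f] unfinished by auto
    \<comment> \<open>\<open>d j\<close> is the position at which the chord from the predecessor of
      \<open>j\<close> in \<open>C\<close> arrives.\<close>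
    define d where "d j = e (inv_into C f j)" for j
    have df: "d (f i) = e i" if "i \<in> C" for i
      using C(3) that by (simp add: d_def bij_betw_def)
    have fC: "f i \<in> C" if "i \<in> C" for i using C(3) that by (auto simp: bij_betw_def)
    have surj: "\<exists>i\<in>C. f i = j" if "j \<in> C" for j using C(3) that unfolding bij_betw_def by (metis imageE)
    have cd: "\<forall>j\<in>C. c j < d j \<and> d j < length (p j)"
    proof
      fix j assume "j \<in> C"
      then obtain i where "i \<in> C" "f i = j" using surj by blast
      then show "c j < d j \<and> d j < length (p j)" using fe df C(1) by auto
    qed
    have ch: "\<forall>i\<in>C. chord E p (p i ! c i) (p (f i) ! d (f i))" using fe df C(1) by auto
    have d: "d i = Suc (c i)" if "i \<in> C" for i
      using tight C(3) cd ch that unfolding tight_def by blast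
    \<comment> \<open>A line fixed by \<open>f\<close> would have a chord between consecutive
      vertices, but these are joined by a line edge.\<close>
    have ne: "f i \<noteq> i" if "i \<in> C" for i
      using ch cd d not_chord_consecutive that by metis
    define s where "s i = (if i \<in> C then f i else i)" for i
    show thesis
    proof (rule twist)
      have "bij_betw s C C" using C(3) by (simp add: s_def cong: bij_betw_cong)
      moreover have "bij_betw s (- C) (- C)" by (auto simp: bij_betw_def inj_on_def s_def)
      ultimately have "bij_betw s (C \<union> - C) (C \<union> - C)" by (rule bij_betw_combine) simp
      then show "bij s" by simp
      show "s \<noteq> id" using C(2) ne by (auto simp: s_def fun_eq_iff)
      show "Suc (c i) < length (p i) \<and> chord E p (p i ! c i) (p (s i) ! Suc (c (s i)))" if "s i \<noteq> i" for i
      proof -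
        have "i \<in> C" using that by (auto simp: s_def split: if_splits)
        then show ?thesis using cd ch d fC by (simp add: s_def)
      qed
    qed
  qed
qed

end

section \<open>Two tokens at a cut\<close>

context tight_linkage
begin

definition before :: "('l \<Rightarrow> nat) \<Rightarrow> 'a set" where
  "before c = {p i ! k | i k. k < c i \<and> k < length (p i)}"

text \<open>The empty path represents a token that has not yet entered its line.\<close>
definition token :: "('l \<Rightarrow> nat) \<Rightarrow> 'l \<Rightarrow> 'a list \<Rightarrow> bool" where
  "token c a P \<longleftrightarrow> set P \<subseteq> before c \<and>
     (if P = [] then c a = 0
      else is_path V E P \<and> hd P \<in> X \<and> 0 < c a \<and> last P = p a ! (c a - 1))"

text \<open>The last vertex before the cut may lie on one of the two paths only for the lines
  \<open>a\<close>, \<open>b\<close> and those in \<open>H\<close>.\<close>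
definition realized :: "('l \<Rightarrow> nat) \<Rightarrow> 'l \<Rightarrow> 'l \<Rightarrow> 'l set \<Rightarrow> bool" where
  "realized c a b H \<longleftrightarrow> a \<noteq> b \<and> (\<exists>P Q. token c a P \<and> token c b Q \<and> non_adjacent E P Q \<and>
     (\<forall>i. i \<notin> H \<longrightarrow> i \<noteq> a \<longrightarrow> i \<noteq> b \<longrightarrow> 0 < c i \<longrightarrow> p i ! (c i - 1) \<notin> set P \<union> set Q))"

text \<open>The piece \<open>A\<close> that a token adds while the cut moves from \<open>c\<close>
  to \<open>c'\<close> and the token from line \<open>a\<close> to line \<open>a'\<close>. An empty
  piece means that the cut rests on the line of the token.\<close>

definition extension :: "('l \<Rightarrow> nat) \<Rightarrow> ('l \<Rightarrow> nat) \<Rightarrow> 'l \<Rightarrow> 'l \<Rightarrow> 'a list \<Rightarrow> bool" where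
  "extension c c' a a' A \<longleftrightarrow>
     (if A = [] then a' = a \<and> c' a = c a
      else hd A = p a ! c a \<and> c a < length (p a) \<and> last A = p a' ! (c' a' - 1) \<and> 0 < c' a' \<and>
        is_path V E A \<and> set A \<subseteq> before c' - before c)"

lemma nth_in_before_iff: "k < length (p i) \<Longrightarrow> p i ! k \<in> before c \<longleftrightarrow> k < c i"
  unfolding before_def using nth_eq_iff by auto

lemma before_mono: "(\<And>i. c i \<le> c' i) \<Longrightarrow> before c \<subseteq> before c'"
  unfolding before_def using less_le_trans by blast

text \<open>Chords do not cross a cut, so only line edges between the two vertices next to it
  do.\<close>

lemma edge_across_cut:
  assumes "cut c" "u \<in> before c" "c i \<le> k" "k < length (p i)" "{u, p i ! k} \<in> E"
  shows "k = c i \<and> 0 < c i \<and> u = p i ! (c i - 1)"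
proof -
  obtain j l where u: "u = p j ! l" "l < c j" "l < length (p j)"
    using assms(2) by (auto simp: before_def)
  have "\<not> chord E p (p j ! l) (p i ! k)"
    using assms(1,3,4) u(2) unfolding cut_def by (metis not_le)
  then have "j = i \<and> (l = Suc k \<or> k = Suc l)" using edge_cases[of j l i k] assms(4,5) u by simp
  then have "c i = Suc l" "k = Suc l" "j = i" using u(2) assms(3) by auto
  then show ?thesis using u(1) by simp
qed

lemma token_extension:
  assumes "\<And>i. c i \<le> c' i" "token c a P" "extension c c' a a' A"
  shows "token c' a' (P @ A)"
proof (cases "A = []")
  case True
  have "before c \<subseteq> before c'" by (rule before_mono) (rule assms(1))
  then show ?thesis using True assms(2,3) by (auto simp: token_def extension_def)
next
  case False
  then have A: "hd A = p a ! c a" "c a < length (p a)" "last A = p a' ! (c' a' - 1)" "0 < c' a'"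
    "is_path V E A" "set A \<subseteq> before c' - before c"
    using assms(3) by (auto simp: extension_def)
  have P: "set P \<subseteq> before c" using assms(2) by (simp add: token_def)
  have sub: "set (P @ A) \<subseteq> before c'" using A(6) P before_mono[of c c'] assms(1) by auto
  show ?thesis
  proof (cases "P = []")
    case True
    \<comment> \<open>A token that has not entered yet starts with the first vertex of its line,
      which lies in \<open>X\<close>.\<close>
    then have "c a = 0" using assms(2) by (simp add: token_def)
    then show ?thesis using True False A sub path_hd[of a] by (simp add: token_def)
  next
    case Pne: False
    then have Q: "is_path V E P" "hd P \<in> X" "0 < c a" "last P = p a ! (c a - 1)"
      using assms(2) by (auto simp: token_def)
    have "{last P, hd A} \<in> E" using path_edge[of "c a - 1" a] Q A by simp
    then have "is_path V E (P @ A)"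
      using Q(1) A(5,6) P by (auto simp: is_path_def path_edges_append)
    then show ?thesis using Pne False A Q sub by (simp add: token_def)
  qed
qed

text \<open>The old part of one path can touch the new piece of the other only through a line edge
  at the cut. On line \<open>b\<close> the vertex before the cut belongs to \<open>Q\<close> and
  hence not to \<open>P\<close>; on the other lines \<open>entry\<close> rules this out.\<close>

lemma non_adjacent_extension:
  assumes c: "cut c" and c': "\<And>i. c' i \<le> length (p i)" and P: "set P \<subseteq> before c" and Q: "token c b Q"
    and PQ: "non_adjacent E P Q" and B: "set B \<subseteq> before c' - before c"
    and entry: "\<And>i. c i < length (p i) \<Longrightarrow> p i ! c i \<in> set B \<Longrightarrow> i = b \<or> (0 < c i \<longrightarrow> p i ! (c i - 1) \<notin> set P)"
  shows "non_adjacent E P B"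
  unfolding non_adjacent_def
proof (intro conjI ballI notI)
  show "set P \<inter> set B = {}" using P B by blast
  fix u v assume u: "u \<in> set P" and v: "v \<in> set B" and uv: "{u, v} \<in> E"
  have "v \<in> before c'" using v B by blast
  then obtain i k where k: "v = p i ! k" "k < length (p i)" by (auto simp: before_def)
  then have "c i \<le> k" using v B nth_in_before_iff[of k i c] by auto
  then have e: "k = c i" "0 < c i" "u = p i ! (c i - 1)"
    using edge_across_cut[OF c, of u i k] u P k uv by auto
  have "i = b" using entry[of i] e k u v by auto
  then have "Q \<noteq> []" "last Q = u" using Q e by (auto simp: token_def split: if_splits)
  then have "u \<in> set Q" using last_in_set by blast
  then show False using PQ u by (auto simp: non_adjacent_def)
qed

lemma non_adjacent_sym: "non_adjacent E P Q \<Longrightarrow> non_adjacent E Q P"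
  unfolding non_adjacent_def by (metis insert_commute disjoint_iff)

text \<open>The common form of all token moves. Call a line hot if its last vertex before the cut
  may be occupied. Old parts are non-adjacent by \<open>r\<close>, new pieces by \<open>AB\<close>,
  and the mixed cases only require that no piece contains the first vertex beyond the cut of a hot
  line other than its own. \<open>H'\<close> has to collect the lines that stay hot or become
  hot.\<close>

lemma realized_extension:
  assumes c: "cut c" and r: "realized c a b H" and mono: "\<And>i. c i \<le> c' i" and len: "\<And>i. c' i \<le> length (p i)"
    and A: "extension c c' a a' A" and B: "extension c c' b b' B" and AB: "non_adjacent E A B" and ne: "a' \<noteq> b'"
    and entryA: "\<And>i. c i < length (p i) \<Longrightarrow> p i ! c i \<in> set A \<Longrightarrow> i = a \<or> i \<notin> H \<and> i \<noteq> b"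
    and entryB: "\<And>i. c i < length (p i) \<Longrightarrow> p i ! c i \<in> set B \<Longrightarrow> i = b \<or> i \<notin> H \<and> i \<noteq> a"
    and hot: "\<And>i. i \<notin> H' \<Longrightarrow> i \<noteq> a' \<Longrightarrow> i \<noteq> b' \<Longrightarrow> c' i = c i \<Longrightarrow> i \<notin> H \<and> i \<noteq> a \<and> i \<noteq> b"
    and hot': "\<And>i. i \<notin> H' \<Longrightarrow> i \<noteq> a' \<Longrightarrow> i \<noteq> b' \<Longrightarrow> c i < c' i \<Longrightarrow> p i ! (c' i - 1) \<notin> set A \<union> set B"
  shows "realized c' a' b' H'"
proof -
  obtain P Q where ab: "a \<noteq> b" and P: "token c a P" and Q: "token c b Q" and PQ: "non_adjacent E P Q"
    and cold: "\<And>i. i \<notin> H \<Longrightarrow> i \<noteq> a \<Longrightarrow> i \<noteq> b \<Longrightarrow> 0 < c i \<Longrightarrow> p i ! (c i - 1) \<notin> set P \<union> set Q"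
    using r unfolding realized_def by blast
  have sub: "set P \<subseteq> before c" "set Q \<subseteq> before c" using P Q by (auto simp: token_def)
  have new: "set A \<subseteq> before c' - before c" "set B \<subseteq> before c' - before c"
    using A B by (auto simp: extension_def split: if_splits)
  have PB: "non_adjacent E P B"
    using non_adjacent_extension[OF c len sub(1) Q PQ new(2)] entryB cold by blast
  have QA: "non_adjacent E Q A"
    using non_adjacent_extension[OF c len sub(2) P non_adjacent_sym[OF PQ] new(1)] entryA cold by blast
  have "non_adjacent E (P @ A) (Q @ B)"
    using PQ PB non_adjacent_sym[OF QA] AB by (auto simp: non_adjacent_def)
  moreover have "p i ! (c' i - 1) \<notin> set (P @ A) \<union> set (Q @ B)"
    if i: "i \<notin> H'" "i \<noteq> a'" "i \<noteq> b'" "0 < c' i" for i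
  proof (cases "c' i = c i")
    case True
    have lt: "c i - 1 < length (p i)" using True i(4) len[of i] by simp
    then have "p i ! (c i - 1) \<in> before c" using True i(4) nth_in_before_iff[OF lt, of c] by simp
    then show ?thesis using cold[of i] hot[OF i(1-3) True] True i(4) new by auto
  next
    case False
    then have less: "c i < c' i" using mono[of i] by simp
    have lt: "c' i - 1 < length (p i)" using i(4) len[of i] by simp
    have "p i ! (c' i - 1) \<notin> before c" using nth_in_before_iff[OF lt, of c] less by simp
    then show ?thesis using hot'[OF i(1-3) less] sub by auto
  qed
  ultimately show ?thesis
    using ne token_extension[OF mono P A] token_extension[OF mono Q B] unfolding realized_def by blast
qed

lemma realized_commute: "realized c a b H \<Longrightarrow> realized c b a H"
  unfolding realized_def using non_adjacent_sym by blast

lemma realized_mono: "realized c a b H \<Longrightarrow> H \<subseteq> H' \<Longrightarrow> realized c a b H'"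
  unfolding realized_def by blast

lemma cut_zero: "cut (\<lambda>_. 0)"
  by (simp add: cut_def)

lemma realized_zero: "a \<noteq> b \<Longrightarrow> realized (\<lambda>_. 0) a b {}"
  unfolding realized_def by (auto simp: token_def non_adjacent_def intro!: exI[of _ "[]"])

text \<open>Lines are nonempty, so at the end both tokens have entered and sit on last vertices of
  lines, which lie in \<open>Y\<close>.\<close>

lemma realized_end:
  assumes "realized c a b H" "\<And>i. c i = length (p i)"
  shows "\<exists>P Q. XY_path V E X Y P \<and> XY_path V E X Y Q \<and> non_adjacent E P Q"
proof -
  obtain P Q where P: "token c a P" and Q: "token c b Q" and PQ: "non_adjacent E P Q"
    using assms(1) unfolding realized_def by blast
  have "XY_path V E X Y R" if "token c i R" for i R
    using that assms(2)[of i] path_nonempty[of i] path_last[of i]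
    by (auto simp: token_def XY_path_def split: if_splits)
  then show ?thesis using P Q PQ by blast
qed

section \<open>Advancing the cut by one vertex per line\<close>

definition advance :: "'l set \<Rightarrow> ('l \<Rightarrow> nat) \<Rightarrow> 'l \<Rightarrow> nat" where
  "advance D c i = (if i \<in> D then Suc (c i) else c i)"

lemma cut_advance:
  assumes c: "cut c" and D: "\<And>i. i \<in> D \<Longrightarrow> c i < length (p i)"
    and partner: "\<And>i v. i \<in> D \<Longrightarrow> chord E p (p i ! c i) v \<Longrightarrow> \<exists>j\<in>D. v = p j ! c j"
  shows "cut (advance D c)"
  unfolding cut_def
proof (intro conjI allI impI)
  show "advance D c i \<le> length (p i)" for i
    using c D[of i] by (auto simp: advance_def cut_def)
  fix i j k l assume k: "k < advance D c i" and l: "l < length (p j)" and ch: "chord E p (p i ! k) (p j ! l)"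
  show "l < advance D c j"
  proof (cases "k < c i")
    case True
    then have "l < c j" using c l ch unfolding cut_def by blast
    then show ?thesis by (simp add: advance_def)
  next
    case False
    then have "i \<in> D" "k = c i" using k by (auto simp: advance_def split: if_splits)
    then obtain h where h: "h \<in> D" "p j ! l = p h ! c h" using partner ch by blast
    then have "j = h \<and> l = c h" using nth_eq_iff[OF l D[OF h(1)]] by simp
    then show ?thesis using h(1) by (simp add: advance_def)
  qed
qed

lemma extension_stay:
  assumes "\<And>i. i \<in> D \<Longrightarrow> c i < length (p i)"
  shows "extension c (advance D c) a a (if a \<in> D then [p a ! c a] else [])"
  using assms[of a] path_in[of "c a" a] nth_in_before_iff[of "c a" a]
  by (auto simp: extension_def advance_def is_path_def)

text \<open>A token on an advancing line takes the next vertex. Every other advancing line gets an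
  unvisited last vertex, so \<open>D\<close> leaves \<open>H\<close>.\<close>

lemma realized_stay:
  assumes c: "cut c" and D: "\<And>i. i \<in> D \<Longrightarrow> c i < length (p i)" and r: "realized c a b H"
    and ab: "\<not> (a \<in> D \<and> b \<in> D \<and> {p a ! c a, p b ! c b} \<in> E)"
  shows "realized (advance D c) a b (H - D)"
proof (rule realized_extension[OF c r _ _ extension_stay[OF D] extension_stay[OF D]])
  show "c i \<le> advance D c i" "advance D c i \<le> length (p i)" for i
    using D[of i] c by (auto simp: advance_def cut_def)
  have "a \<noteq> b" using r by (simp add: realized_def)
  then show "a \<noteq> b" .
  show "non_adjacent E (if a \<in> D then [p a ! c a] else []) (if b \<in> D then [p b ! c b] else [])"
    using ab \<open>a \<noteq> b\<close> D nth_eq_iff by (auto simp: non_adjacent_def)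
  show "i = a \<or> i \<notin> H \<and> i \<noteq> b" if "c i < length (p i)" "p i ! c i \<in> set (if a \<in> D then [p a ! c a] else [])" for i
    using that D nth_eq_iff[of "c i" i] by (auto split: if_splits)
  show "i = b \<or> i \<notin> H \<and> i \<noteq> a" if "c i < length (p i)" "p i ! c i \<in> set (if b \<in> D then [p b ! c b] else [])" for i
    using that D nth_eq_iff[of "c i" i] by (auto split: if_splits)
  show "i \<notin> H \<and> i \<noteq> a \<and> i \<noteq> b" if "i \<notin> H - D" "i \<noteq> a" "i \<noteq> b" "advance D c i = c i" for i
    using that by (auto simp: advance_def split: if_splits)
  show "p i ! (advance D c i - 1) \<notin> set (if a \<in> D then [p a ! c a] else []) \<union> set (if b \<in> D then [p b ! c b] else [])"
    if "i \<noteq> a" "i \<noteq> b" "c i < advance D c i" for i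
    using that D nth_eq_iff[of "c i" i] by (auto simp: advance_def split: if_splits)
qed

text \<open>The token on \<open>i\<close> takes its next vertex and crosses to \<open>j\<close>. The
  vertex it reaches there is adjacent to the last vertex of \<open>j\<close> before the old cut, if
  any; as \<open>H\<close> does not record which path occupies that vertex, \<open>j\<close> must be
  cold. Line \<open>i\<close> now ends in a visited vertex and joins \<open>H\<close>.\<close>

lemma realized_switch:
  assumes c: "cut c" and r: "realized c i b H" and ij: "i \<noteq> j" "b \<noteq> j" "j \<notin> H"
    and len: "c i < length (p i)" "c j < length (p j)" and edge: "{p i ! c i, p j ! c j} \<in> E"
  shows "realized (advance {i, j} c) j b (insert i H)"
proof -
  have D: "\<And>k. k \<in> {i, j} \<Longrightarrow> c k < length (p k)" using len by auto
  have ib: "i \<noteq> b" using r by (auto simp: realized_def)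
  have "p i ! c i \<noteq> p j ! c j" using nth_eq_iff[OF len] ij by simp
  then have "extension c (advance {i, j} c) i j [p i ! c i, p j ! c j]"
    using len edge path_in nth_in_before_iff by (auto simp: extension_def advance_def is_path_def)
  moreover have "extension c (advance {i, j} c) b b []" using ij ib by (simp add: extension_def advance_def)
  ultimately show ?thesis
  proof (rule realized_extension[OF c r, rotated 2])
    show "c k \<le> advance {i, j} c k" "advance {i, j} c k \<le> length (p k)" for k
      using D[of k] c by (auto simp: advance_def cut_def)
    show "non_adjacent E [p i ! c i, p j ! c j] []" by (simp add: non_adjacent_def)
    show "j \<noteq> b" using ij by simp
    show "k = i \<or> k \<notin> H \<and> k \<noteq> b" if "c k < length (p k)" "p k ! c k \<in> set [p i ! c i, p j ! c j]" for k
      using that ij nth_eq_iff[OF that(1) len(1)] nth_eq_iff[OF that(1) len(2)] by auto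
    show "k = b \<or> k \<notin> H \<and> k \<noteq> i" if "p k ! c k \<in> set []" for k using that by simp
    show "k \<notin> H \<and> k \<noteq> i \<and> k \<noteq> b" if "k \<notin> insert i H" "k \<noteq> b" for k using that by simp
    show "p k ! (advance {i, j} c k - 1) \<notin> set [p i ! c i, p j ! c j] \<union> set []"
      if "k \<notin> insert i H" "k \<noteq> j" "c k < advance {i, j} c k" for k
      using that by (auto simp: advance_def split: if_splits)
  qed
qed

definition twisted :: "('l \<Rightarrow> 'l) \<Rightarrow> ('l \<Rightarrow> nat) \<Rightarrow> 'l \<Rightarrow> nat" where
  "twisted s c i = (if s i = i then c i else Suc (Suc (c i)))"

end

section \<open>Moving both tokens across a twist\<close>

locale twist = tight_linkage V E X Y p
  for V :: "'a set" and E :: "'a set set" and X Y :: "'a set" and p :: "'l :: finite \<Rightarrow> 'a list" +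
  fixes s :: "'l \<Rightarrow> 'l" and c :: "'l \<Rightarrow> nat"
  assumes cut: "cut c" and bij: "bij s"
    and twist_len: "s i \<noteq> i \<Longrightarrow> Suc (c i) < length (p i)"
    and twist_chord: "s i \<noteq> i \<Longrightarrow> chord E p (p i ! c i) (p (s i) ! Suc (c (s i)))"
begin

lemma moved_image: "s i \<noteq> i \<Longrightarrow> s (s i) \<noteq> s i"
  using bij by (metis bij_is_inj injD)

text \<open>The matching fixes all chords at the two new vertices of a moved line: the first goes to
  the second new vertex of the image line, the second to the first new vertex of the preimage line.
  So none of them crosses the new cut.\<close>

lemma cut_twisted: "cut (twisted s c)"
  unfolding cut_def
proof (intro conjI allI impI)
  show "twisted s c i \<le> length (p i)" for i
    using cut twist_len[of i] by (auto simp: twisted_def cut_def)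
  fix i j k l assume k: "k < twisted s c i" and l: "l < length (p j)" and ch: "chord E p (p i ! k) (p j ! l)"
  consider "k < c i" | "s i \<noteq> i" "k = c i" | "s i \<noteq> i" "k = Suc (c i)"
    using k by (cases "s i = i") (auto simp: twisted_def less_Suc_eq)
  then show "l < twisted s c j"
  proof cases
    case 1
    then have "l < c j" using cut l ch unfolding cut_def by blast
    then show ?thesis by (simp add: twisted_def)
  next
    case 2
    have "p j ! l = p (s i) ! Suc (c (s i))" using chord_unique[OF ch] twist_chord[OF 2(1)] 2(2) by simp
    then have "j = s i \<and> l = Suc (c (s i))" using nth_eq_iff[OF l twist_len[OF moved_image[OF 2(1)]]] by simp
    then show ?thesis using moved_image[OF 2(1)] by (simp add: twisted_def)
  next
    case 3
    obtain h where h: "s h = i" using bij by (metis bij_pointE)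
    then have "s h \<noteq> h" using 3 by auto
    have "p j ! l = p h ! c h"
      using chord_unique[OF ch] chord_sym[OF twist_chord[OF \<open>s h \<noteq> h\<close>]] h 3(2) by simp
    then have "j = h \<and> l = c h" using nth_eq_iff[OF l, of "c h" h] twist_len[OF \<open>s h \<noteq> h\<close>] by simp
    then show ?thesis using \<open>s h \<noteq> h\<close> by (simp add: twisted_def)
  qed
qed

text \<open>Here \<open>x\<close> is meant to be \<open>a\<close>, reached along the line, or
  \<open>s a\<close>, reached along the chord. Either way one further vertex completes the
  move.\<close>

definition crossing :: "'l \<Rightarrow> 'l \<Rightarrow> 'a list" where
  "crossing a x = (if s a = a then [] else [p a ! c a, p x ! Suc (c x)])"

lemma extension_crossing:
  assumes "x \<in> {a, s a}"
  shows "extension c (twisted s c) a x (crossing a x)"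
proof (cases "s a = a")
  case True
  then show ?thesis using assms by (simp add: extension_def crossing_def twisted_def)
next
  case False
  have x: "s x \<noteq> x" using assms False moved_image by auto
  note la = twist_len[OF False] and lx = twist_len[OF x]
  have la': "c a < length (p a)" using la by simp
  have "{p a ! c a, p x ! Suc (c x)} \<in> E"
    using assms path_edge[OF la] twist_chord[OF False] by (auto simp: chord_def)
  moreover have "p a ! c a \<noteq> p x ! Suc (c x)" using nth_eq_iff[OF la' lx] by auto
  ultimately show ?thesis
    using False x la' lx path_in[OF la'] path_in[OF lx] nth_in_before_iff[OF la'] nth_in_before_iff[OF lx]
    by (auto simp: extension_def crossing_def twisted_def is_path_def)
qed

text \<open>Offset 0 marks the first and offset 1 the second new vertex of a moved line. Line edges
  and chords alike join a first vertex to a second one.\<close>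

lemma edge_in_twist:
  assumes "s a \<noteq> a" "s b \<noteq> b" "k \<le> 1" "l \<le> 1" "{p a ! (c a + k), p b ! (c b + l)} \<in> E"
  shows "k \<noteq> l \<and> (a = b \<or> k = 0 \<and> b = s a \<or> l = 0 \<and> a = s b)"
proof -
  have len: "c a + k < length (p a)" "c b + l < length (p b)"
    using twist_len[OF assms(1)] twist_len[OF assms(2)] assms(3,4) by auto
  from edge_cases[OF assms(5) len] show ?thesis
  proof
    assume ch: "chord E p (p a ! (c a + k)) (p b ! (c b + l))"
    show ?thesis
    proof (cases "k = 0")
      case True
      then have "p b ! (c b + l) = p (s a) ! Suc (c (s a))"
        using chord_unique[OF ch] twist_chord[OF assms(1)] by simp
      then have "b = s a \<and> c b + l = Suc (c (s a))"
        using nth_eq_iff[OF len(2) twist_len[OF moved_image[OF assms(1)]]] by blast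
      then have "b = s a" "l = 1" by auto
      then show ?thesis using True by simp
    next
      case False
      then have k: "k = 1" using assms(3) by simp
      obtain h where h: "s h = a" using bij by (metis bij_pointE)
      then have "s h \<noteq> h" using assms(1) by auto
      then have "p b ! (c b + l) = p h ! c h"
        using chord_unique[OF ch] chord_sym[OF twist_chord[of h]] h k by simp
      then have "b = h \<and> c b + l = c h"
        using nth_eq_iff[OF len(2), of "c h" h] twist_len[OF \<open>s h \<noteq> h\<close>] by force
      then have "b = h" "l = 0" by auto
      then show ?thesis using k h by simp
    qed
  qed auto
qed

text \<open>Among the new vertices, the first one of \<open>a\<close> is adjacent only to the second
  ones of \<open>a\<close> and \<open>s a\<close>; so the conditions on \<open>x\<close> and
  \<open>y\<close> keep the pieces apart. Hot lines are no obstacle, because only its own token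
  visits the first new vertex of a line. The second one is visited only on a destination line, so
  all other moved lines turn cold.\<close>

lemma realized_twisted:
  assumes r: "realized c a b H" and x: "x \<in> {a, s a}" and y: "y \<in> {b, s b}"
    and xy: "x \<notin> {b, s b}" "y \<notin> {a, s a}"
  shows "realized (twisted s c) x y {i \<in> H. s i = i}"
proof (rule realized_extension[OF cut r _ _ extension_crossing[OF x] extension_crossing[OF y]])
  show "c i \<le> twisted s c i" "twisted s c i \<le> length (p i)" for i
    using cut_twisted by (auto simp: twisted_def cut_def)
  show "x \<noteq> y" using x xy by auto
  have ab: "a \<noteq> b" using r by (simp add: realized_def)
  have mv: "s x \<noteq> x" if "s a \<noteq> a" using x that moved_image by auto
  have mv': "s y \<noteq> y" if "s b \<noteq> b" using y that moved_image by auto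
  show "non_adjacent E (crossing a x) (crossing b y)"
  proof (cases "s a = a \<or> s b = b")
    case True
    then show ?thesis by (auto simp: crossing_def non_adjacent_def)
  next
    case False
    then have a: "s a \<noteq> a" and b: "s b \<noteq> b" by auto
    note sx = mv[OF a] and sy = mv'[OF b]
    have len: "c a < length (p a)" "c b < length (p b)" "Suc (c x) < length (p x)" "Suc (c y) < length (p y)"
      using twist_len[OF a] twist_len[OF b] twist_len[OF sx] twist_len[OF sy] by auto
    have "{p a ! c a, p b ! c b} \<notin> E" using edge_in_twist[OF a b, of 0 0] by auto
    moreover have "{p a ! c a, p y ! Suc (c y)} \<notin> E"
      using edge_in_twist[OF a sy, of 0 1] xy by auto
    moreover have "{p x ! Suc (c x), p b ! c b} \<notin> E"
      using edge_in_twist[OF sx b, of 1 0] xy by auto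
    moreover have "{p x ! Suc (c x), p y ! Suc (c y)} \<notin> E"
      using edge_in_twist[OF sx sy, of 1 1] by auto
    moreover have "p a ! c a \<noteq> p b ! c b" "p a ! c a \<noteq> p y ! Suc (c y)"
      "p x ! Suc (c x) \<noteq> p b ! c b" "p x ! Suc (c x) \<noteq> p y ! Suc (c y)"
      using nth_eq_iff[OF len(1,2)] nth_eq_iff[OF len(1,4)] nth_eq_iff[OF len(3,2)] nth_eq_iff[OF len(3,4)]
        ab xy x y by auto
    ultimately show ?thesis using a b by (simp add: crossing_def non_adjacent_def)
  qed
  show "i = a \<or> i \<notin> H \<and> i \<noteq> b" if "c i < length (p i)" "p i ! c i \<in> set (crossing a x)" for i
  proof -
    have moved: "s a \<noteq> a" and eq: "p i ! c i = p a ! c a \<or> p i ! c i = p x ! Suc (c x)"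
      using that(2) by (auto simp: crossing_def split: if_splits)
    have "c a < length (p a)" using twist_len[OF moved] by simp
    \<comment> \<open>A first new vertex cannot be a second one, as \<open>c x\<close> and
      \<open>Suc (c x)\<close> differ; this leaves \<open>i = a\<close>.\<close>
    from nth_eq_iff[OF that(1) this] nth_eq_iff[OF that(1) twist_len[OF mv[OF moved]]] eq
    show ?thesis by (metis n_not_Suc_n)
  qed
  show "i = b \<or> i \<notin> H \<and> i \<noteq> a" if "c i < length (p i)" "p i ! c i \<in> set (crossing b y)" for i
  proof -
    have moved: "s b \<noteq> b" and eq: "p i ! c i = p b ! c b \<or> p i ! c i = p y ! Suc (c y)"
      using that(2) by (auto simp: crossing_def split: if_splits)
    have "c b < length (p b)" using twist_len[OF moved] by simp
    from nth_eq_iff[OF that(1) this] nth_eq_iff[OF that(1) twist_len[OF mv'[OF moved]]] eq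
    show ?thesis by (metis n_not_Suc_n)
  qed
  show "i \<notin> H \<and> i \<noteq> a \<and> i \<noteq> b" if "i \<notin> {i \<in> H. s i = i}" "i \<noteq> x" "i \<noteq> y" "twisted s c i = c i" for i
    using that x y by (auto simp: twisted_def split: if_splits)
  show "p i ! (twisted s c i - 1) \<notin> set (crossing a x) \<union> set (crossing b y)"
    if "i \<noteq> x" "i \<noteq> y" "c i < twisted s c i" for i
  proof -
    have i: "s i \<noteq> i" using that(3) by (auto simp: twisted_def split: if_splits)
    have *: "p i ! Suc (c i) \<notin> set (crossing d z)" if "i \<noteq> z" "z \<in> {d, s d}" for d z
    proof (cases "s d = d")
      case False
      then have z: "s z \<noteq> z" using that moved_image by auto
      have "c d < length (p d)" using twist_len[OF False] by simp
      from nth_eq_iff[OF twist_len[OF i] this] nth_eq_iff[OF twist_len[OF i] twist_len[OF z]] that(1)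
      have "p i ! Suc (c i) \<noteq> p d ! c d" "p i ! Suc (c i) \<noteq> p z ! Suc (c z)" by (metis n_not_Suc_n)+
      then show ?thesis using False by (simp add: crossing_def)
    qed (simp add: crossing_def)
    then show ?thesis using i that x y by (simp add: twisted_def)
  qed
qed

end

section \<open>The invariant for five lines\<close>

datatype line = L0 | L1 | L2 | L3 | L4

lemma UNIV_line: "UNIV = {L0, L1, L2, L3, L4}"
proof -
  have "i \<in> {L0, L1, L2, L3, L4}" for i by (cases i) simp_all
  then show ?thesis by blast
qed

instance line :: finite
  by standard (simp add: UNIV_line)

type_synonym state = "line \<times> line \<times> line list"

primrec line_index :: "line \<Rightarrow> nat" where
  "line_index L0 = 0"
| "line_index L1 = 1"
| "line_index L2 = 2"
| "line_index L3 = 3"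
| "line_index L4 = 4"

definition relabel :: "line list \<Rightarrow> line \<Rightarrow> line" where
  "relabel xs i = xs ! line_index i"

text \<open>The states supplied by \<open>realized_stay\<close> and \<open>realized_switch\<close>.
  Tokens on both ends of the rung would become adjacent, so such a state is lost.\<close>

fun rung_succ :: "line \<Rightarrow> line \<Rightarrow> state \<Rightarrow> state list" where
  "rung_succ i j (a, b, H) =
     (if (a = i \<or> a = j) \<and> (b = i \<or> b = j) then []
      else (a, b, filter (\<lambda>x. x \<noteq> i \<and> x \<noteq> j) H) #
        (if a = i \<and> j \<notin> set H then [(j, b, i # H)] else []) @
        (if a = j \<and> i \<notin> set H then [(i, b, j # H)] else []) @
        (if b = i \<and> j \<notin> set H then [(j, a, i # H)] else []) @
        (if b = j \<and> i \<notin> set H then [(i, a, j # H)] else []))"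

text \<open>Mirrors \<open>realized_twisted\<close>. On a fixed line the two options of a token
  coincide, which only repeats entries.\<close>

fun twist_succ :: "(line \<Rightarrow> line) \<Rightarrow> state \<Rightarrow> state list" where
  "twist_succ s (a, b, H) =
     [(x, y, filter (\<lambda>z. s z = z) H). x \<leftarrow> [a, s a], y \<leftarrow> [b, s b],
        x \<noteq> b \<and> x \<noteq> s b \<and> y \<noteq> a \<and> y \<noteq> s a]"

text \<open>The order of the tokens is irrelevant by \<open>realized_commute\<close>, and a smaller
  \<open>H\<close> is a stronger state by \<open>realized_mono\<close>.\<close>

fun covered :: "state list \<Rightarrow> line list \<Rightarrow> state \<Rightarrow> bool" where
  "covered [] r (a, b, H) \<longleftrightarrow> False"
| "covered ((a', b', H') # S) r (a, b, H) \<longleftrightarrow>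
     (a' = relabel r a \<and> b' = relabel r b \<or> a' = relabel r b \<and> b' = relabel r a) \<and>
       set H' \<subseteq> set (map (relabel r) H) \<or>
     covered S r (a, b, H)"

lemma coveredD:
  "covered S r (a, b, H) \<Longrightarrow> \<exists>a' b' H'. (a', b', H') \<in> set S \<and>
    (a' = relabel r a \<and> b' = relabel r b \<or> a' = relabel r b \<and> b' = relabel r a) \<and>
    set H' \<subseteq> relabel r ` set H"
proof (induction S)
  case (Cons x S)
  obtain a' b' H' where x: "x = (a', b', H')" by (cases x)
  show ?case
  proof (cases "covered S r (a, b, H)")
    case True
    then show ?thesis using Cons.IH by (meson list.set_intros(2))
  next
    case False
    then show ?thesis using Cons.prems x by (intro exI[of _ a'] exI[of _ b'] exI[of _ H']) simp
  qed
qed simp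

text \<open>The patterns were found by a computer search, as the minimal sets of states that can arise when
  starting from all pairs of lines with empty \<open>H\<close>.\<close>
datatype pattern =
    P0 | P1 | P2 | P3 | P4 | P5 | P6 | P7 | P8 | P9 | P10 | P11 | P12 | P13 | P14 | P15 | P16
    | P17 | P18 | P19 | P20 | P21 | P22 | P23

primrec states_of :: "pattern \<Rightarrow> state list" where
  "states_of P0 = [(L0,L3,[]), (L0,L4,[]), (L1,L2,[]), (L1,L3,[])]"
| "states_of P1 = [(L0,L3,[]), (L1,L2,[]), (L1,L3,[]), (L3,L4,[L0])]"
| "states_of P2 = [(L0,L3,[]), (L1,L3,[]), (L2,L3,[L1]), (L3,L4,[L0])]"
| "states_of P3 = [(L0,L1,[L3]), (L0,L2,[L1,L3]), (L1,L3,[]), (L2,L3,[L1]), (L3,L4,[])]"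
| "states_of P4 = [(L0,L1,[L3]), (L0,L3,[L1,L2]), (L1,L2,[L0,L3]), (L1,L3,[]), (L2,L3,[L1]),
     (L3,L4,[])]"
| "states_of P5 = [(L0,L1,[L3]), (L1,L2,[]), (L1,L3,[]), (L3,L4,[])]"
| "states_of P6 = [(L0,L1,[L3]), (L0,L3,[]), (L1,L2,[]), (L1,L4,[L0,L3]), (L2,L3,[L1]), (L3,L4,[L0])]"
| "states_of P7 = [(L0,L1,[L3]), (L0,L4,[]), (L1,L2,[]), (L1,L3,[]), (L3,L4,[L0])]"
| "states_of P8 = [(L0,L1,[]), (L1,L2,[]), (L1,L4,[L3]), (L2,L3,[L1]), (L3,L4,[])]"
| "states_of P9 = [(L0,L1,[]), (L1,L2,[]), (L1,L4,[]), (L2,L3,[L1]), (L2,L4,[L1,L3])]"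
| "states_of P10 = [(L0,L1,[]), (L0,L4,[]), (L1,L2,[]), (L1,L4,[L0,L3]), (L2,L3,[L1]), (L3,L4,[L0])]"
| "states_of P11 = [(L0,L1,[]), (L0,L2,[L1]), (L1,L4,[L3]), (L2,L3,[]), (L2,L4,[L1,L3]), (L3,L4,[])]"
| "states_of P12 = [(L0,L1,[]), (L0,L2,[L1]), (L0,L4,[]), (L1,L4,[L0,L3]), (L2,L3,[]), (L3,L4,[L0])]"
| "states_of P13 = [(L0,L1,[]), (L0,L2,[L1]), (L0,L3,[L1,L2]), (L0,L4,[]), (L1,L4,[L0]),
     (L2,L4,[L0,L3]), (L3,L4,[L0])]"
| "states_of P14 = [(L0,L2,[]), (L0,L4,[L1,L3]), (L1,L4,[L3]), (L2,L3,[]), (L2,L4,[L3]), (L3,L4,[])]"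
| "states_of P15 = [(L0,L3,[L2]), (L0,L4,[L1,L3]), (L0,L4,[L2,L3]), (L1,L4,[L3]), (L2,L3,[]),
     (L2,L4,[L3]), (L3,L4,[])]"
| "states_of P16 = [(L0,L1,[]), (L0,L2,[L1]), (L1,L4,[]), (L2,L3,[]), (L2,L4,[L1]), (L2,L4,[L3])]"
| "states_of P17 = [(L0,L1,[]), (L0,L2,[L1]), (L0,L3,[L1,L2]), (L1,L4,[]), (L2,L4,[]), (L3,L4,[L1,L2])]"
| "states_of P18 = [(L0,L1,[]), (L0,L2,[L1]), (L0,L3,[L1]), (L0,L4,[L1,L2]), (L1,L2,[L4]), (L1,L4,[]),
     (L3,L4,[L1])]"
| "states_of P19 = [(L0,L1,[]), (L0,L2,[L1]), (L0,L4,[L1,L2]), (L1,L2,[L3,L4]), (L1,L4,[L3]),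
     (L2,L3,[]), (L3,L4,[])]"
| "states_of P20 = [(L0,L1,[]), (L0,L2,[L1]), (L1,L4,[L0]), (L1,L4,[L3]), (L2,L3,[]), (L2,L4,[L0,L1]),
     (L3,L4,[])]"
| "states_of P21 = [(L0,L1,[]), (L0,L2,[L1]), (L1,L3,[L0,L4]), (L1,L4,[]), (L2,L3,[]), (L2,L4,[L3]),
     (L2,L4,[L0,L1])]"
| "states_of P22 = [(L0,L1,[]), (L0,L2,[L1]), (L0,L3,[L1,L2]), (L1,L3,[L0,L4]), (L1,L4,[]), (L2,L4,[])]"
| "states_of P23 = [(L0,L2,[]), (L0,L3,[L2]), (L0,L4,[L1]), (L1,L3,[L4]), (L1,L4,[]), (L2,L4,[])]"

text \<open>Every event leads from a pattern to a relabelling of one of its targets; a list \<open>r\<close> maps the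
  line with index \<open>k\<close> to \<open>r ! k\<close>.\<close>
primrec targets :: "pattern \<Rightarrow> (pattern \<times> line list) list" where
  "targets P0 = [(P0,[L0,L1,L2,L3,L4]), (P0,[L0,L3,L2,L1,L4]), (P0,[L1,L3,L4,L0,L2]),
     (P0,[L2,L3,L4,L1,L0]), (P0,[L3,L4,L1,L0,L2]), (P2,[L0,L1,L2,L3,L4]), (P0,[L0,L2,L3,L1,L4]),
     (P0,[L1,L4,L0,L3,L2]), (P1,[L0,L1,L2,L3,L4]), (P1,[L1,L0,L4,L3,L2]), (P0,[L0,L3,L4,L2,L1]),
     (P0,[L1,L3,L2,L4,L0]), (P1,[L0,L1,L4,L3,L2]), (P1,[L0,L3,L1,L4,L2]), (P0,[L0,L2,L1,L3,L4]),
     (P0,[L0,L2,L3,L4,L1]), (P0,[L0,L3,L2,L4,L1]), (P0,[L1,L3,L4,L2,L0]), (P0,[L1,L4,L3,L2,L0]),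
     (P0,[L2,L3,L0,L4,L1]), (P1,[L1,L0,L2,L3,L4]), (P7,[L0,L1,L2,L3,L4]), (P7,[L1,L0,L4,L3,L2])]"
| "targets P1 = [(P1,[L0,L1,L2,L3,L4]), (P0,[L0,L3,L2,L1,L4]), (P0,[L3,L4,L1,L0,L2]),
     (P2,[L0,L1,L2,L3,L4]), (P3,[L3,L0,L4,L1,L2]), (P5,[L4,L1,L2,L3,L0]), (P5,[L0,L1,L2,L3,L4]),
     (P0,[L1,L3,L2,L4,L0]), (P1,[L0,L2,L1,L3,L4]), (P0,[L0,L3,L2,L4,L1]), (P0,[L1,L3,L2,L0,L4]),
     (P1,[L0,L4,L2,L3,L1]), (P6,[L0,L1,L2,L3,L4])]"
| "targets P2 = [(P2,[L0,L1,L2,L3,L4]), (P3,[L0,L1,L2,L3,L4]), (P3,[L1,L0,L4,L3,L2]),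
     (P1,[L0,L1,L3,L2,L4]), (P1,[L1,L0,L3,L4,L2]), (P0,[L0,L3,L2,L1,L4]), (P0,[L1,L3,L4,L0,L2]),
     (P0,[L2,L3,L4,L0,L1]), (P0,[L3,L4,L0,L1,L2]), (P3,[L2,L0,L4,L3,L1]), (P3,[L4,L1,L2,L3,L0])]"
| "targets P3 = [(P3,[L0,L1,L2,L3,L4]), (P0,[L1,L3,L0,L2,L4]), (P0,[L2,L3,L1,L0,L4]),
     (P2,[L1,L2,L4,L3,L0]), (P3,[L2,L3,L4,L1,L0]), (P0,[L1,L4,L3,L0,L2]), (P1,[L0,L2,L4,L1,L3]),
     (P0,[L0,L2,L1,L4,L3]), (P4,[L0,L1,L2,L3,L4]), (P0,[L0,L3,L4,L2,L1]), (P0,[L1,L3,L0,L4,L2]),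
     (P0,[L2,L3,L0,L4,L1]), (P1,[L2,L0,L3,L1,L4]), (P1,[L2,L0,L4,L1,L3]), (P3,[L4,L3,L2,L1,L0])]"
| "targets P4 = [(P2,[L1,L4,L2,L3,L0]), (P5,[L0,L2,L4,L1,L3]), (P0,[L1,L3,L2,L0,L4]),
     (P3,[L3,L1,L2,L0,L4]), (P2,[L0,L3,L4,L1,L2]), (P4,[L0,L1,L2,L3,L4]), (P0,[L3,L4,L1,L2,L0]),
     (P7,[L0,L3,L4,L2,L1]), (P1,[L0,L3,L4,L1,L2]), (P0,[L0,L1,L4,L2,L3])]"
| "targets P5 = [(P5,[L0,L1,L2,L3,L4]), (P0,[L0,L1,L4,L2,L3]), (P5,[L0,L1,L4,L3,L2]),
     (P1,[L2,L0,L1,L3,L4]), (P2,[L0,L3,L4,L1,L2]), (P3,[L0,L1,L2,L3,L4]), (P1,[L1,L0,L2,L3,L4]),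
     (P0,[L1,L3,L0,L2,L4]), (P1,[L0,L1,L4,L3,L2]), (P1,[L3,L2,L1,L4,L0]), (P0,[L1,L2,L3,L0,L4]),
     (P3,[L1,L3,L0,L4,L2]), (P0,[L1,L3,L2,L0,L4]), (P3,[L2,L1,L0,L3,L4]), (P8,[L0,L1,L2,L3,L4])]"
| "targets P6 = [(P1,[L0,L2,L1,L3,L4]), (P5,[L2,L0,L4,L1,L3]), (P1,[L0,L1,L3,L2,L4]),
     (P2,[L0,L1,L2,L3,L4]), (P5,[L4,L1,L2,L0,L3]), (P5,[L2,L4,L0,L1,L3]), (P6,[L0,L1,L2,L3,L4]),
     (P3,[L1,L0,L4,L3,L2]), (P1,[L0,L4,L3,L1,L2])]"
| "targets P7 = [(P5,[L3,L1,L2,L0,L4]), (P0,[L1,L3,L0,L4,L2]), (P0,[L1,L2,L3,L0,L4]),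
     (P5,[L4,L1,L2,L3,L0]), (P6,[L1,L0,L4,L3,L2]), (P0,[L0,L2,L1,L3,L4]), (P0,[L0,L3,L1,L4,L2]),
     (P7,[L0,L1,L2,L3,L4]), (P2,[L0,L1,L2,L3,L4]), (P0,[L0,L2,L4,L1,L3]), (P1,[L2,L1,L0,L3,L4]),
     (P0,[L0,L1,L4,L2,L3]), (P0,[L0,L1,L4,L3,L2]), (P0,[L1,L3,L0,L2,L4]), (P0,[L1,L4,L0,L3,L2]),
     (P1,[L0,L4,L2,L3,L1]), (P5,[L0,L1,L2,L3,L4]), (P10,[L0,L1,L2,L3,L4])]"
| "targets P8 = [(P1,[L0,L4,L3,L1,L2]), (P0,[L1,L4,L0,L2,L3]), (P0,[L1,L2,L0,L3,L4]),
     (P2,[L0,L2,L3,L1,L4]), (P1,[L1,L0,L2,L4,L3]), (P0,[L0,L2,L4,L3,L1]), (P8,[L0,L1,L2,L3,L4]),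
     (P0,[L1,L2,L4,L0,L3]), (P1,[L1,L3,L4,L2,L0]), (P11,[L0,L1,L2,L3,L4]), (P0,[L1,L4,L2,L0,L3]),
     (P0,[L0,L1,L3,L4,L2]), (P0,[L0,L2,L1,L3,L4]), (P0,[L0,L4,L1,L3,L2]), (P0,[L1,L3,L4,L2,L0]),
     (P9,[L0,L1,L2,L3,L4])]"
| "targets P9 = [(P0,[L1,L2,L0,L4,L3]), (P1,[L3,L1,L0,L2,L4]), (P2,[L0,L2,L3,L1,L4]),
     (P5,[L0,L2,L3,L1,L4]), (P0,[L1,L4,L0,L2,L3]), (P0,[L1,L2,L3,L4,L0]), (P3,[L3,L2,L0,L1,L4]),
     (P9,[L0,L1,L2,L3,L4]), (P0,[L2,L3,L4,L1,L0]), (P3,[L3,L2,L4,L1,L0]), (P16,[L0,L1,L2,L3,L4])]"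
| "targets P10 = [(P5,[L3,L1,L2,L0,L4]), (P0,[L1,L2,L0,L4,L3]), (P8,[L0,L1,L2,L3,L4]),
     (P5,[L1,L4,L0,L3,L2]), (P0,[L1,L4,L2,L0,L3]), (P10,[L0,L1,L2,L3,L4]), (P1,[L2,L3,L0,L1,L4]),
     (P0,[L0,L3,L2,L1,L4]), (P0,[L2,L4,L1,L3,L0]), (P0,[L0,L2,L3,L1,L4]), (P1,[L2,L0,L4,L1,L3]),
     (P1,[L4,L1,L2,L0,L3]), (P12,[L0,L1,L2,L3,L4])]"
| "targets P11 = [(P5,[L1,L2,L0,L3,L4]), (P0,[L0,L2,L1,L4,L3]), (P3,[L2,L3,L4,L1,L0]),
     (P5,[L2,L4,L3,L1,L0]), (P1,[L0,L2,L1,L3,L4]), (P1,[L0,L1,L3,L2,L4]), (P0,[L0,L3,L4,L2,L1]),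
     (P3,[L0,L1,L3,L4,L2]), (P19,[L0,L1,L2,L3,L4]), (P0,[L1,L4,L0,L3,L2]), (P3,[L1,L4,L0,L3,L2]),
     (P7,[L0,L3,L4,L2,L1]), (P14,[L0,L1,L2,L3,L4]), (P16,[L0,L1,L2,L3,L4])]"
| "targets P12 = [(P0,[L0,L1,L2,L4,L3]), (P1,[L1,L2,L3,L0,L4]), (P0,[L0,L4,L2,L3,L1]),
     (P2,[L1,L4,L3,L0,L2]), (P5,[L1,L4,L0,L3,L2]), (P1,[L0,L4,L2,L1,L3]), (P1,[L1,L4,L2,L0,L3]),
     (P20,[L0,L1,L2,L3,L4]), (P13,[L0,L1,L2,L3,L4]), (P0,[L0,L2,L3,L1,L4]), (P0,[L0,L2,L4,L1,L3]),
     (P3,[L3,L4,L2,L0,L1])]"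
| "targets P13 = [(P1,[L3,L0,L1,L4,L2]), (P1,[L2,L4,L0,L1,L3]), (P3,[L4,L1,L2,L0,L3]),
     (P2,[L1,L4,L2,L0,L3]), (P2,[L1,L2,L3,L4,L0]), (P2,[L1,L2,L3,L0,L4]), (P13,[L0,L1,L2,L3,L4]),
     (P0,[L0,L3,L4,L2,L1]), (P1,[L1,L0,L2,L4,L3]), (P1,[L3,L1,L0,L4,L2]), (P2,[L1,L4,L3,L0,L2])]"
| "targets P14 = [(P1,[L1,L2,L0,L4,L3]), (P0,[L3,L4,L0,L2,L1]), (P5,[L1,L2,L0,L3,L4]),
     (P0,[L0,L2,L1,L4,L3]), (P9,[L0,L3,L4,L1,L2]), (P3,[L0,L1,L4,L3,L2]), (P0,[L0,L3,L1,L4,L2]),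
     (P1,[L0,L4,L1,L2,L3]), (P14,[L0,L1,L2,L3,L4]), (P1,[L0,L2,L1,L3,L4]), (P1,[L4,L2,L0,L3,L1]),
     (P3,[L1,L4,L0,L3,L2]), (P6,[L3,L2,L0,L4,L1]), (P15,[L0,L1,L2,L3,L4])]"
| "targets P15 = [(P5,[L0,L4,L1,L2,L3]), (P0,[L1,L4,L3,L0,L2]), (P1,[L1,L2,L0,L4,L3]),
     (P2,[L2,L4,L1,L3,L0]), (P9,[L0,L3,L4,L1,L2]), (P0,[L2,L4,L0,L1,L3]), (P3,[L1,L4,L2,L3,L0]),
     (P13,[L3,L2,L0,L1,L4]), (P1,[L1,L0,L3,L4,L2]), (P3,[L1,L4,L0,L3,L2])]"
| "targets P16 = [(P1,[L3,L4,L1,L2,L0]), (P0,[L2,L4,L3,L0,L1]), (P0,[L0,L2,L4,L1,L3]),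
     (P1,[L1,L4,L0,L2,L3]), (P3,[L0,L1,L2,L4,L3]), (P1,[L0,L2,L3,L1,L4]), (P0,[L1,L3,L0,L4,L2]),
     (P3,[L2,L4,L3,L1,L0]), (P5,[L2,L3,L4,L1,L0]), (P16,[L0,L1,L2,L3,L4]), (P0,[L0,L1,L2,L3,L4]),
     (P0,[L0,L2,L1,L3,L4]), (P0,[L2,L4,L0,L3,L1]), (P1,[L1,L2,L3,L0,L4]), (P6,[L3,L0,L1,L2,L4]),
     (P7,[L2,L1,L0,L4,L3]), (P17,[L0,L1,L2,L3,L4])]"
| "targets P17 = [(P5,[L3,L4,L2,L1,L0]), (P0,[L0,L1,L2,L3,L4]), (P5,[L1,L0,L4,L2,L3]),
     (P3,[L2,L0,L3,L1,L4]), (P3,[L3,L1,L4,L2,L0]), (P3,[L3,L2,L4,L1,L0]), (P0,[L1,L4,L0,L2,L3]),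
     (P2,[L0,L2,L3,L1,L4]), (P17,[L0,L1,L2,L3,L4]), (P2,[L1,L2,L3,L0,L4]), (P2,[L1,L2,L3,L4,L0]),
     (P3,[L2,L4,L3,L1,L0]), (P18,[L0,L1,L2,L3,L4])]"
| "targets P18 = [(P5,[L1,L0,L3,L4,L2]), (P3,[L0,L4,L2,L1,L3]), (P0,[L0,L4,L3,L1,L2]),
     (P3,[L3,L0,L4,L1,L2]), (P0,[L0,L1,L3,L2,L4]), (P2,[L0,L4,L2,L1,L3]), (P4,[L3,L4,L2,L1,L0]),
     (P0,[L0,L2,L3,L4,L1]), (P0,[L0,L4,L1,L3,L2]), (P0,[L1,L3,L4,L0,L2]), (P2,[L0,L4,L3,L1,L2]),
     (P3,[L3,L0,L2,L1,L4])]"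
| "targets P19 = [(P5,[L3,L1,L0,L4,L2]), (P5,[L1,L2,L0,L3,L4]), (P0,[L0,L2,L1,L4,L3]),
     (P0,[L0,L3,L1,L2,L4]), (P3,[L1,L4,L0,L3,L2]), (P0,[L1,L4,L2,L0,L3]), (P5,[L2,L1,L0,L4,L3]),
     (P19,[L0,L1,L2,L3,L4]), (P0,[L0,L3,L2,L4,L1]), (P1,[L0,L2,L3,L1,L4]), (P6,[L3,L2,L0,L4,L1]),
     (P7,[L0,L3,L4,L2,L1])]"
| "targets P20 = [(P5,[L0,L4,L3,L1,L2]), (P5,[L4,L2,L3,L0,L1]), (P0,[L1,L4,L0,L2,L3]),
     (P5,[L2,L4,L3,L1,L0]), (P0,[L0,L3,L1,L2,L4]), (P0,[L0,L4,L2,L1,L3]), (P0,[L1,L2,L3,L4,L0]),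
     (P0,[L1,L2,L4,L0,L3]), (P0,[L2,L4,L0,L3,L1]), (P19,[L0,L1,L2,L3,L4]), (P0,[L2,L4,L1,L3,L0]),
     (P1,[L3,L1,L0,L4,L2]), (P21,[L0,L1,L2,L3,L4])]"
| "targets P21 = [(P0,[L1,L2,L3,L4,L0]), (P0,[L1,L4,L0,L3,L2]), (P0,[L0,L1,L4,L2,L3]),
     (P1,[L0,L4,L3,L1,L2]), (P1,[L1,L3,L4,L0,L2]), (P1,[L3,L0,L4,L2,L1]), (P3,[L2,L4,L3,L1,L0]),
     (P0,[L0,L1,L2,L4,L3]), (P1,[L3,L0,L1,L2,L4]), (P22,[L0,L1,L2,L3,L4]), (P1,[L0,L4,L1,L2,L3]),
     (P2,[L0,L4,L2,L1,L3])]"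
| "targets P22 = [(P5,[L3,L0,L4,L2,L1]), (P5,[L3,L1,L0,L4,L2]), (P0,[L0,L4,L2,L3,L1]),
     (P2,[L0,L4,L2,L1,L3]), (P0,[L3,L4,L0,L2,L1]), (P0,[L0,L4,L1,L2,L3]), (P0,[L0,L1,L2,L3,L4]),
     (P17,[L0,L1,L2,L3,L4]), (P0,[L0,L2,L3,L1,L4]), (P1,[L0,L3,L2,L1,L4]), (P2,[L1,L2,L3,L0,L4]),
     (P23,[L0,L1,L2,L3,L4])]"
| "targets P23 = [(P1,[L2,L4,L1,L0,L3]), (P0,[L0,L4,L3,L2,L1]), (P0,[L0,L3,L2,L4,L1]),
     (P3,[L3,L1,L0,L4,L2]), (P1,[L0,L4,L1,L2,L3]), (P1,[L3,L1,L2,L0,L4]), (P0,[L1,L2,L0,L4,L3]),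
     (P0,[L3,L4,L0,L1,L2]), (P1,[L2,L3,L1,L0,L4]), (P0,[L2,L4,L3,L0,L1]), (P12,[L2,L4,L1,L3,L0])]"

fun reaches :: "state list \<Rightarrow> (pattern \<times> line list) list \<Rightarrow> bool" where
  "reaches S [] \<longleftrightarrow> False"
| "reaches S ((F, r) # ts) \<longleftrightarrow> list_all (covered S r) (states_of F) \<or> reaches S ts"

lemma reaches_iff: "reaches S ts \<longleftrightarrow> (\<exists>(F, r) \<in> set ts. list_all (covered S r) (states_of F))"
  by (induction ts) auto

definition closed_under :: "(state \<Rightarrow> state list) \<Rightarrow> bool" where
  "closed_under f = list_all (\<lambda>F. reaches (concat (map f (states_of F))) (targets F))
    [P0, P1, P2, P3, P4, P5, P6, P7, P8, P9, P10, P11, P12, P13, P14, P15, P16, P17, P18, P19,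
     P20, P21, P22, P23]"

primrec closed_under_all :: "(state \<Rightarrow> state list) list \<Rightarrow> bool" where
  "closed_under_all [] \<longleftrightarrow> True"
| "closed_under_all (f # fs) \<longleftrightarrow> closed_under f \<and> closed_under_all fs"

lemma closed_under_all_iff: "closed_under_all fs \<longleftrightarrow> (\<forall>f\<in>set fs. closed_under f)"
  by (induction fs) auto

text \<open>Sorting the permutations by the image \<open>a\<close> of \<open>L0\<close> splits the
  check into five evaluations.\<close>

definition twist_events :: "line \<Rightarrow> line list list" where
  "twist_events a = filter (\<lambda>r. distinct r \<and> r \<noteq> [L0, L1, L2, L3, L4])
     (map ((#) a) (List.n_lists 4 [L0, L1, L2, L3, L4]))"

lemma in_all_lines: "i \<in> set [L0, L1, L2, L3, L4]"
  by (cases i) simp_all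

lemma closed_under_rung:
  assumes "i \<noteq> j"
  shows "closed_under (rung_succ i j)"
proof -
  have "closed_under_all [rung_succ i j. i \<leftarrow> [L0, L1, L2, L3, L4], j \<leftarrow> [L0, L1, L2, L3, L4], i \<noteq> j]"
    by code_simp
  moreover have "rung_succ i j \<in> set [rung_succ i j. i \<leftarrow> [L0, L1, L2, L3, L4], j \<leftarrow> [L0, L1, L2, L3, L4], i \<noteq> j]"
    using assms in_all_lines[of i] in_all_lines[of j] by auto
  ultimately show ?thesis unfolding closed_under_all_iff by blast
qed

lemma closed_under_twist_events0: "closed_under_all (map (\<lambda>r. twist_succ (relabel r)) (twist_events L0))"
  by code_simp

lemma closed_under_twist_events1: "closed_under_all (map (\<lambda>r. twist_succ (relabel r)) (twist_events L1))"
  by code_simp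

lemma closed_under_twist_events2: "closed_under_all (map (\<lambda>r. twist_succ (relabel r)) (twist_events L2))"
  by code_simp

lemma closed_under_twist_events3: "closed_under_all (map (\<lambda>r. twist_succ (relabel r)) (twist_events L3))"
  by code_simp

lemma closed_under_twist_events4: "closed_under_all (map (\<lambda>r. twist_succ (relabel r)) (twist_events L4))"
  by code_simp

text \<open>A permutation of the lines is determined by its five values, so \<open>s\<close> is one
  of the 119 non-identical ones evaluated above.\<close>

lemma closed_under_twist:
  assumes "bij s" "s \<noteq> id"
  shows "closed_under (twist_succ s)"
proof -
  let ?r = "[s L0, s L1, s L2, s L3, s L4]"
  have s: "s = relabel ?r"
  proof
    show "s i = relabel ?r i" for i by (cases i) (simp_all add: relabel_def)
  qed
  have "distinct ?r" using bij_is_inj[OF assms(1)] by (simp add: inj_eq)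
  moreover have "?r \<noteq> [L0, L1, L2, L3, L4]"
  proof
    assume "?r = [L0, L1, L2, L3, L4]"
    then have "s i = id i" for i by (cases i) simp_all
    then show False using assms(2) by blast
  qed
  moreover have "[s L1, s L2, s L3, s L4] \<in> set (List.n_lists 4 [L0, L1, L2, L3, L4])"
    using in_all_lines unfolding set_n_lists by auto
  ultimately have "?r \<in> set (twist_events (s L0))" by (simp add: twist_events_def)
  moreover have "closed_under_all (map (\<lambda>r. twist_succ (relabel r)) (twist_events (s L0)))"
    by (cases "s L0") (simp_all only: closed_under_twist_events0 closed_under_twist_events1
        closed_under_twist_events2 closed_under_twist_events3 closed_under_twist_events4)
  ultimately have "closed_under (twist_succ (relabel ?r))"
    unfolding closed_under_all_iff by (metis image_eqI set_map)
  then show ?thesis using s by simp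
qed

lemma bij_relabel:
  assumes "(F, r) \<in> set (targets G)"
  shows "bij (relabel r)"
proof -
  have "list_all (\<lambda>(F, r). length r = 5 \<and> distinct r) (targets G)" by (cases G) simp_all
  then have r: "length r = 5" "distinct r" using assms by (auto simp: list_all_iff)
  have less: "line_index i < 5" for i by (cases i) simp_all
  have "inj line_index"
  proof (rule injI)
    show "i = j" if "line_index i = line_index j" for i j using that by (cases i; cases j) simp_all
  qed
  then have "inj (relabel r)"
    using r less by (auto simp: inj_def relabel_def nth_eq_iff_index_eq)
  then show ?thesis by (simp add: finite_UNIV_inj_surj bij_def)
qed

section \<open>Sweeping the cut over five lines\<close>

locale five_lines = tight_linkage V E X Y p
  for V :: "'a set" and E :: "'a set set" and X Y :: "'a set" and p :: "line \<Rightarrow> 'a list"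
begin

text \<open>\<open>f\<close> sends the labels of the pattern to the actual lines.\<close>

definition good :: "(line \<Rightarrow> nat) \<Rightarrow> bool" where
  "good c \<longleftrightarrow> (\<exists>F f. bij f \<and> (\<forall>(a, b, H) \<in> set (states_of F). realized c (f a) (f b) (f ` set H)))"

text \<open>Transfers the finite check to paths: the realized successors cover some target
  \<open>G\<close> renamed by \<open>r\<close>, so \<open>G\<close> is realized under the labelling
  \<open>f \<circ> relabel r\<close>.\<close>

lemma good_step:
  assumes closed: "closed_under succ" and f: "bij f"
    and step: "\<And>a b H a' b' H'. (a, b, H) \<in> set (states_of F) \<Longrightarrow> (a', b', H') \<in> set (succ (a, b, H)) \<Longrightarrow>
      realized c (f a') (f b') (f ` set H')"
  shows "good c"
proof -
  have "reaches (concat (map succ (states_of F))) (targets F)"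
    using closed unfolding closed_under_def by (cases F) simp_all
  then obtain G r where G: "(G, r) \<in> set (targets F)"
    and cov: "list_all (covered (concat (map succ (states_of F))) r) (states_of G)"
    unfolding reaches_iff by blast
  have "realized c ((f \<circ> relabel r) a) ((f \<circ> relabel r) b) ((f \<circ> relabel r) ` set H)"
    if abH: "(a, b, H) \<in> set (states_of G)" for a b H
  proof -
    have "covered (concat (map succ (states_of F))) r (a, b, H)" using cov abH by (simp add: list_all_iff)
    from coveredD[OF this] obtain a' b' H' where in_S: "(a', b', H') \<in> set (concat (map succ (states_of F)))"
      and ab: "a' = relabel r a \<and> b' = relabel r b \<or> a' = relabel r b \<and> b' = relabel r a"
      and H: "set H' \<subseteq> relabel r ` set H"
      by blast
    have "realized c (f a') (f b') (f ` set H')" using in_S step by auto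
    then have "realized c (f a') (f b') ((f \<circ> relabel r) ` set H)"
      by (rule realized_mono) (use H in auto)
    then show ?thesis using ab realized_commute by auto
  qed
  moreover have "bij (f \<circ> relabel r)" using bij_relabel[OF G] f by (rule bij_comp)
  ultimately show ?thesis unfolding good_def by blast
qed

text \<open>Both tokens stay on their lines and \<open>H\<close> can only shrink, so pattern and
  labelling are kept.\<close>

lemma good_single:
  assumes "cut c" "good c" "c i < length (p i)"
  shows "good (advance {i} c)"
proof -
  obtain F f where f: "bij f" and F: "\<forall>(a, b, H) \<in> set (states_of F). realized c (f a) (f b) (f ` set H)"
    using assms(2) unfolding good_def by blast
  have "realized (advance {i} c) (f a) (f b) (f ` set H)" if "(a, b, H) \<in> set (states_of F)" for a b H
  proof -
    have r: "realized c (f a) (f b) (f ` set H)" using F that by blast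
    then have "f a \<noteq> f b" by (simp add: realized_def)
    then have "realized (advance {i} c) (f a) (f b) (f ` set H - {i})"
      using assms(3) by (intro realized_stay[OF assms(1) _ r]) auto
    then show ?thesis by (rule realized_mono) blast
  qed
  then show ?thesis unfolding good_def using f by blast
qed

lemma good_rung:
  assumes c: "cut c" and g: "good c" and ij: "i \<noteq> j" and len: "c i < length (p i)" "c j < length (p j)"
    and edge: "{p i ! c i, p j ! c j} \<in> E"
  shows "good (advance {i, j} c)"
proof -
  obtain F f where f: "bij f" and F: "\<forall>(a, b, H) \<in> set (states_of F). realized c (f a) (f b) (f ` set H)"
    using g unfolding good_def by blast
  have inj: "f x = f y \<longleftrightarrow> x = y" for x y using f by (simp add: bij_is_inj inj_eq)
  \<comment> \<open>The check speaks about the labels of the pattern, so the rung is pulled back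
    along \<open>f\<close>.\<close>
  obtain i0 j0 where i0: "i = f i0" "j = f j0" using f by (metis bij_pointE)
  have ne: "i0 \<noteq> j0" using ij i0 by auto
  have len': "\<And>k. k \<in> {i, j} \<Longrightarrow> c k < length (p k)" using len by auto
  have edge': "{p j ! c j, p i ! c i} \<in> E" using edge by (simp add: insert_commute)
  have switch: "realized (advance {i, j} c) (f y) (f b) (f ` set (x # H))"
    if r: "realized c (f x) (f b) (f ` set H)" and xy: "x = i0 \<and> y = j0 \<or> x = j0 \<and> y = i0"
      and b: "b \<noteq> y" and H: "y \<notin> set H" for x y b H
  proof -
    have "f y \<notin> f ` set H" using H inj by auto
    moreover have "f b \<noteq> f y" "f x \<noteq> f y" using b xy ne inj by auto
    ultimately have "realized (advance {f x, f y} c) (f y) (f b) (insert (f x) (f ` set H))"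
      using xy i0 len edge edge' by (intro realized_switch[OF c r]) auto
    moreover have "{f x, f y} = {i, j}" using xy i0 by auto
    ultimately show ?thesis by simp
  qed
  show ?thesis
  proof (rule good_step[OF closed_under_rung[OF ne] f])
    fix a b H a' b' H'
    assume abH: "(a, b, H) \<in> set (states_of F)" and succ: "(a', b', H') \<in> set (rung_succ i0 j0 (a, b, H))"
    have r: "realized c (f a) (f b) (f ` set H)" using F abH by blast
    have ab: "a \<noteq> b" using r by (auto simp: realized_def)
    have nd: "\<not> ((a = i0 \<or> a = j0) \<and> (b = i0 \<or> b = j0))"
      using succ by (auto split: if_splits)
    then consider "(a', b', H') = (a, b, filter (\<lambda>x. x \<noteq> i0 \<and> x \<noteq> j0) H)"
      | x y where "x = i0 \<and> y = j0 \<or> x = j0 \<and> y = i0" "a = x" "y \<notin> set H" "(a', b', H') = (y, b, x # H)"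
      | x y where "x = i0 \<and> y = j0 \<or> x = j0 \<and> y = i0" "b = x" "y \<notin> set H" "(a', b', H') = (y, a, x # H)"
      using succ by (auto split: if_splits)
    then show "realized (advance {i, j} c) (f a') (f b') (f ` set H')"
    proof cases
      case 1
      have "realized (advance {i, j} c) (f a) (f b) (f ` set H - {i, j})"
      proof (rule realized_stay[OF c len' r])
        show "\<not> (f a \<in> {i, j} \<and> f b \<in> {i, j} \<and> {p (f a) ! c (f a), p (f b) ! c (f b)} \<in> E)"
          using nd i0 inj by auto
      qed
      moreover have "f ` set H' = f ` set H - {i, j}" using 1 i0 inj by auto
      ultimately show ?thesis using 1 by simp
    next
      case 2
      then show ?thesis using switch[of x b H y] r nd by auto
    next
      case 3
      then show ?thesis using switch[of x a H y] realized_commute[OF r] nd by auto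
    qed
  qed
qed

lemma good_twist:
  assumes c: "cut c" and g: "good c" and s: "bij s" "s \<noteq> id"
    and tw: "\<And>i. s i \<noteq> i \<Longrightarrow> Suc (c i) < length (p i) \<and> chord E p (p i ! c i) (p (s i) ! Suc (c (s i)))"
  shows "cut (twisted s c)" "good (twisted s c)"
proof -
  interpret twist V E X Y p s c by unfold_locales (use c s tw in auto)
  show "cut (twisted s c)" by (rule cut_twisted)
  obtain F f where f: "bij f" and F: "\<forall>(a, b, H) \<in> set (states_of F). realized c (f a) (f b) (f ` set H)"
    using g unfolding good_def by blast
  have inj: "f x = f y \<longleftrightarrow> x = y" for x y using f by (simp add: bij_is_inj inj_eq)
  \<comment> \<open>The twist as a permutation of the labels.\<close>
  define t where "t = inv f \<circ> s \<circ> f"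
  have ft: "f (t x) = s (f x)" for x using f by (simp add: t_def bij_is_surj surj_f_inv_f)
  have t: "bij t" unfolding t_def using f s(1) by (simp add: bij_comp bij_imp_bij_inv)
  have "t \<noteq> id"
  proof
    assume "t = id"
    then have "s (f x) = f x" for x using ft[of x] by simp
    then have "s y = id y" for y using f by (metis bij_pointE id_apply)
    then show False using s(2) by blast
  qed
  show "good (twisted s c)"
  proof (rule good_step[OF closed_under_twist[OF t \<open>t \<noteq> id\<close>] f])
    fix a b H x y H'
    assume abH: "(a, b, H) \<in> set (states_of F)" and succ: "(x, y, H') \<in> set (twist_succ t (a, b, H))"
    have r: "realized c (f a) (f b) (f ` set H)" using F abH by blast
    have *: "x \<in> {a, t a}" "y \<in> {b, t b}" "x \<notin> {b, t b}" "y \<notin> {a, t a}" "H' = filter (\<lambda>z. t z = z) H"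
      using succ by (auto split: if_splits)
    have "realized (twisted s c) (f x) (f y) {i \<in> f ` set H. s i = i}"
      using * by (intro realized_twisted[OF r]) (auto simp: ft[symmetric] inj)
    moreover have "{i \<in> f ` set H. s i = i} = f ` set H'"
      using * by (auto simp: ft[symmetric] inj)
    ultimately show "realized (twisted s c) (f x) (f y) (f ` set H')" by simp
  qed
qed

text \<open>At the start every pair of distinct lines is realized with empty \<open>H\<close>. The
  four pairs of \<open>P0\<close> form a path through all five lines.\<close>

lemma good_zero: "good (\<lambda>_. 0)"
proof -
  have "\<forall>(a, b, H) \<in> set (states_of P0). realized (\<lambda>_. 0) (id a) (id b) (id ` set H)"
    using realized_zero by auto
  then show ?thesis unfolding good_def using bij_id by blast
qed

text \<open>Induction on the number of vertices beyond the cut: every event moves the cut forward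
  and preserves \<open>good\<close>.\<close>

lemma ex_non_adjacent_paths_from:
  "cut c \<Longrightarrow> good c \<Longrightarrow> \<exists>P Q. XY_path V E X Y P \<and> XY_path V E X Y Q \<and> non_adjacent E P Q"
proof (induction "\<Sum>i\<in>UNIV. length (p i) - c i" arbitrary: c rule: less_induct)
  case less
  have le: "c i \<le> length (p i)" for i using less.prems(1) by (simp add: cut_def)
  have decrease: "(\<Sum>i\<in>UNIV. length (p i) - c' i) < (\<Sum>i\<in>UNIV. length (p i) - c i)"
    if "cut c'" "\<And>i. c i \<le> c' i" "c j < c' j" for c' j
  proof (rule sum_strict_mono_ex1)
    show "\<forall>i\<in>UNIV. length (p i) - c' i \<le> length (p i) - c i" using that(2) by (simp add: diff_le_mono2)
    have "c' j \<le> length (p j)" using that(1) by (simp add: cut_def)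
    then have "length (p j) - c' j < length (p j) - c j" using that(3) by simp
    then show "\<exists>i\<in>UNIV. length (p i) - c' i < length (p i) - c i" by blast
  qed simp
  have continue: ?case if "cut c'" "good c'" "\<And>i. c i \<le> c' i" "c j < c' j" for c' j
    using less.hyps[OF decrease[OF that(1,3,4)] that(1,2)] .
  show ?case
  proof (cases "\<forall>i. c i = length (p i)")
    case True
    obtain F f where F: "\<forall>(a, b, H) \<in> set (states_of F). realized c (f a) (f b) (f ` set H)"
      using less.prems(2) unfolding good_def by blast
    \<comment> \<open>Any single state of the pattern provides the two paths.\<close>
    have "states_of F \<noteq> []" by (cases F) simp_all
    then obtain a b H where "(a, b, H) \<in> set (states_of F)" by (metis list.set_intros(1) neq_Nil_conv prod_cases3)
    then have "realized c (f a) (f b) (f ` set H)" using F by blast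
    then show ?thesis using realized_end True by blast
  next
    case False
    then obtain i0 where "c i0 < length (p i0)" using le by (metis le_neq_implies_less)
    with less.prems(1) show ?thesis
    proof (cases rule: next_event)
      case (single i)
      have "cut (advance {i} c)" using single by (intro cut_advance[OF less.prems(1)]) auto
      then show ?thesis
        by (rule continue[where j = i]) (use good_single[OF less.prems single(1)] in \<open>simp_all add: advance_def\<close>)
    next
      case (rung i j)
      have "cut (advance {i, j} c)"
      proof (rule cut_advance[OF less.prems(1)])
        show "c k < length (p k)" if "k \<in> {i, j}" for k using that rung by auto
        show "\<exists>l\<in>{i, j}. v = p l ! c l" if "k \<in> {i, j}" "chord E p (p k ! c k) v" for k v
          using that chord_unique[OF rung(4)] chord_unique[OF chord_sym[OF rung(4)]] by auto
      qed
      moreover have "good (advance {i, j} c)"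
        using rung by (intro good_rung[OF less.prems]) (auto simp: chord_def)
      ultimately show ?thesis by (rule continue[where j = i]) (simp_all add: advance_def)
    next
      case (twist s)
      note tw = good_twist[OF less.prems twist]
      obtain i where "s i \<noteq> i" using twist(2) by (auto simp: fun_eq_iff)
      then show ?thesis by (intro continue[OF tw, where j = i]) (simp_all add: twisted_def)
    qed
  qed
qed

lemma ex_non_adjacent_paths: "\<exists>P Q. XY_path V E X Y P \<and> XY_path V E X Y Q \<and> non_adjacent E P Q"
  using ex_non_adjacent_paths_from[OF cut_zero good_zero] .

end

section \<open>From collections of paths to oriented, indexed linkages\<close>

lemma ex_non_adjacent_XY_paths:
  fixes V :: "'a set"
  assumes G: "fin_graph V E" and P: "disjoint_XY_paths V E X Y 5 \<P>"
    and deg: "\<forall>v \<in> paths_verts \<P>. card {e \<in> E - paths_edges \<P>. v \<in> e} \<le> 1"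
  shows "\<exists>p q. XY_path V E X Y p \<and> XY_path V E X Y q \<and> non_adjacent E p q"
proof -
  have card_line: "card (UNIV :: line set) = 5" by (simp add: UNIV_line)
  have "finite \<P>" "card \<P> = 5" using P by (auto simp: disjoint_XY_paths_def)
  then obtain g :: "line \<Rightarrow> 'a list" where g: "bij_betw g UNIV \<P>"
    using finite_same_card_bij[of "UNIV :: line set" \<P>] card_line by auto
  have gP: "g i \<in> \<P>" for i using g by (auto simp: bij_betw_def)
  have range_g: "range g = \<P>" using g by (simp add: bij_betw_def)
  \<comment> \<open>Paths that run from \<open>Y\<close> to \<open>X\<close> are reversed.\<close>
  define p where "p i = (if hd (g i) \<in> X \<and> last (g i) \<in> Y then g i else rev (g i))" for i
  have set_p [simp]: "set (p i) = set (g i)" and edges_p [simp]: "path_edges (p i) = path_edges (g i)" for i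
    by (auto simp: p_def)
  have "linkage V E X Y p"
    unfolding linkage_def
  proof (intro conjI allI impI)
    fix i
    have gi: "XY_path V E X Y (g i)" using P gP by (simp add: disjoint_XY_paths_def)
    then have "g i \<noteq> []" "distinct (g i)" by (auto simp: XY_path_def is_path_def)
    then have "p i \<noteq> []" "distinct (p i)" by (auto simp: p_def)
    then show "is_path V E (p i)" using gi by (simp add: XY_path_def is_path_def)
    show "hd (p i) \<in> X" "last (p i) \<in> Y"
      using gi \<open>g i \<noteq> []\<close> by (auto simp: p_def XY_path_def hd_rev last_rev)
  next
    fix i j :: line assume "i \<noteq> j"
    then have "g i \<noteq> g j" using g by (auto simp: bij_betw_def inj_eq)
    then show "set (p i) \<inter> set (p j) = {}" using P gP by (simp add: disjoint_XY_paths_def)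
  qed
  moreover have "chords_matching E p"
    unfolding chords_matching_def
  proof (intro allI impI)
    fix u v w assume uv: "chord E p u v" and uw: "chord E p u w"
    let ?S = "{e \<in> E - paths_edges \<P>. u \<in> e}"
    have edges: "paths_edges \<P> = (\<Union>i. path_edges (p i))" using range_g by (auto simp: paths_edges_def)
    have "u \<in> paths_verts \<P>" using uv gP by (auto simp: chord_def paths_verts_def)
    then have "card ?S \<le> 1" using deg by blast
    moreover have "finite ?S"
    proof (rule finite_subset)
      show "?S \<subseteq> Pow V" using G by (auto simp: fin_graph_def)
      show "finite (Pow V)" using G by (simp add: fin_graph_def)
    qed
    \<comment> \<open>Both chords at \<open>u\<close> are edges outside the collection, and
      \<open>u\<close> has at most one of these.\<close>
    moreover have "{u, v} \<in> ?S" "{u, w} \<in> ?S" using uv uw by (auto simp: chord_def edges)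
    ultimately have "{u, v} = {u, w}" by (metis One_nat_def card_le_Suc0_iff_eq)
    then show "v = w" by (auto simp: doubleton_eq_iff)
  qed
  ultimately obtain q :: "line \<Rightarrow> 'a list" where "linkage V E X Y q" "chords_matching E q" "tight E q"
    using ex_tight_linkage by blast
  moreover have "{v} \<notin> E" for v using G by (auto simp: fin_graph_def)
  ultimately interpret five_lines V E X Y q by unfold_locales
  show ?thesis by (rule ex_non_adjacent_paths)
qed

section \<open>The two counterexamples\<close>

text \<open>In \<open>confined N B ys n ws C\<close> and \<open>no_pair N xs ys n ps\<close>, the number \<open>n\<close> bounds the steps of a
  depth-first search with stack \<open>ws\<close> or \<open>ps\<close>; if it runs out, the result is \<open>False\<close>.\<close>
fun confined :: "('a \<Rightarrow> 'a list) \<Rightarrow> 'a list \<Rightarrow> 'a list \<Rightarrow> nat \<Rightarrow> 'a list \<Rightarrow> 'a list \<Rightarrow> bool" where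
  "confined N B ys 0 ws C \<longleftrightarrow> False"
| "confined N B ys (Suc n) [] C \<longleftrightarrow> True"
| "confined N B ys (Suc n) (w # ws) C \<longleftrightarrow>
     (if w \<in> set C \<or> w \<in> set B then confined N B ys n ws C
      else w \<notin> set ys \<and> confined N B ys n (N w @ ws) (w # C))"

text \<open>The paths in \<open>ps\<close> are stored in reverse, with their current end at the head.\<close>
fun no_pair :: "('a \<Rightarrow> 'a list) \<Rightarrow> 'a list \<Rightarrow> 'a list \<Rightarrow> nat \<Rightarrow> 'a list list \<Rightarrow> bool" where
  "no_pair N xs ys 0 ps \<longleftrightarrow> False"
| "no_pair N xs ys (Suc n) [] \<longleftrightarrow> True"
| "no_pair N xs ys (Suc n) (p # ps) \<longleftrightarrow>
     (if confined N (p @ concat (map N p)) ys 100 xs [] then no_pair N xs ys n ps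
      else hd p \<notin> set ys \<and>
        no_pair N xs ys n (map (\<lambda>w. w # p) (filter (\<lambda>w. w \<notin> set p) (N (hd p))) @ ps))"

text \<open>The second assumption is the loop invariant: all neighbours of collected vertices are
  blocked, collected or waiting on the stack. \<open>D\<close> is the collection once the stack is
  empty.\<close>

lemma confined_closure:
  assumes "confined N B ys n ws C" "\<And>u. u \<in> set C \<Longrightarrow> u \<notin> set ys \<and> set (N u) \<subseteq> set B \<union> set C \<union> set ws"
  shows "\<exists>D. set C \<subseteq> D \<and> set ws \<subseteq> set B \<union> D \<and> (\<forall>u\<in>D. u \<notin> set ys \<and> set (N u) \<subseteq> set B \<union> D)"
  using assms
proof (induction N B ys n ws C rule: confined.induct)
  case (2 N B ys n C)
  then show ?case by (intro exI[of _ "set C"]) auto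
next
  case (3 N B ys n w ws C)
  show ?case
  proof (cases "w \<in> set C \<or> w \<in> set B")
    case True
    have "\<exists>D. set C \<subseteq> D \<and> set ws \<subseteq> set B \<union> D \<and> (\<forall>u\<in>D. u \<notin> set ys \<and> set (N u) \<subseteq> set B \<union> D)"
    proof (rule "3.IH"(1)[OF True])
      show "confined N B ys n ws C" using "3.prems"(1) True by simp
      show "u \<notin> set ys \<and> set (N u) \<subseteq> set B \<union> set C \<union> set ws" if "u \<in> set C" for u
        using "3.prems"(2)[OF that] True by auto
    qed
    then show ?thesis using True by auto
  next
    case False
    then have w: "w \<notin> set ys" "confined N B ys n (N w @ ws) (w # C)" using "3.prems"(1) by auto
    have "\<exists>D. set (w # C) \<subseteq> D \<and> set (N w @ ws) \<subseteq> set B \<union> D \<and>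
        (\<forall>u\<in>D. u \<notin> set ys \<and> set (N u) \<subseteq> set B \<union> D)"
    proof (rule "3.IH"(2)[OF False w(2)])
      show "u \<notin> set ys \<and> set (N u) \<subseteq> set B \<union> set (w # C) \<union> set (N w @ ws)" if "u \<in> set (w # C)" for u
        using "3.prems"(2)[of u] w(1) that by auto
    qed
    then show ?thesis by auto
  qed
qed simp

text \<open>A path can leave \<open>D\<close> only through \<open>B\<close>.\<close>

lemma path_in_closed_set:
  assumes "path_edges q \<subseteq> E" "\<And>u w. {u, w} \<in> E \<Longrightarrow> w \<in> N u" "\<And>u. u \<in> D \<Longrightarrow> N u \<subseteq> B \<union> D"
    "q \<noteq> []" "hd q \<in> D" "set q \<inter> B = {}"
  shows "set q \<subseteq> D"
  using assms(1,4,5,6)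
proof (induction q)
  case (Cons x q)
  show ?case
  proof (cases q)
    case Nil
    then show ?thesis using Cons.prems by simp
  next
    case (Cons y q')
    have "y \<in> N x" using Cons.prems(1) Cons assms(2)[of x y] by simp
    then have "y \<in> D" using Cons.prems(3,4) Cons assms(3)[of x] by auto
    then have "set q \<subseteq> D" using Cons.prems Cons by (intro Cons.IH) auto
    then show ?thesis using Cons.prems(3) by simp
  qed
qed simp

text \<open>The induction needs the split \<open>r @ t\<close> into a prefix on the stack and an
  arbitrary continuation. A prefix below the top stays on the stack. At the top, either
  \<open>q\<close> is cut off from \<open>ys\<close>, or the search pushes \<open>r\<close> extended
  by the first vertex of \<open>t\<close>.\<close>

lemma no_pair_sound:
  assumes N: "\<And>u w. {u, w} \<in> E \<Longrightarrow> w \<in> set (N u)"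
    and NE: "\<And>u w. u \<in> V \<Longrightarrow> w \<in> set (N u) \<Longrightarrow> {u, w} \<in> E"
    and q: "is_path V E q" "hd q \<in> set xs" "last q \<in> set ys"
  shows "no_pair N xs ys n ps \<Longrightarrow> rev r \<in> set ps \<Longrightarrow> r \<noteq> [] \<Longrightarrow> is_path V E (r @ t) \<Longrightarrow>
    last (r @ t) \<in> set ys \<Longrightarrow> \<not> non_adjacent E (r @ t) q"
proof (induction n arbitrary: ps r t)
  case 0
  then show ?case by simp
next
  case (Suc n)
  obtain p ps' where ps: "ps = p # ps'" using Suc.prems(2) by (cases ps) auto
  show ?case
  proof (cases "rev r = p")
    case False
    then have "rev r \<in> set ps'" using Suc.prems(2) ps by simp
    \<comment> \<open>\<open>ps''\<close> is empty or consists of the extensions of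
      \<open>p\<close>, depending on the branch taken.\<close>
    moreover obtain ps'' where "no_pair N xs ys n (ps'' @ ps')"
      using Suc.prems(1) ps append_Nil by (metis no_pair.simps(3))
    ultimately show ?thesis using Suc.prems(3-5) by (intro Suc.IH[of "ps'' @ ps'"]) auto
  next
    case p: True
    show ?thesis
    proof
      assume nadj: "non_adjacent E (r @ t) q"
      have q': "q \<noteq> []" "path_edges q \<subseteq> E" using q(1) by (auto simp: is_path_def)
      have rV: "set r \<subseteq> V" using Suc.prems(4) by (auto simp: is_path_def)
      let ?B = "p @ concat (map N p)"
      \<comment> \<open>Non-adjacency keeps \<open>q\<close> off the closed neighbourhood of
        \<open>r\<close>, so \<open>q\<close> stays in the region explored from
        \<open>xs\<close>.\<close>
      have avoid: "set q \<inter> set ?B = {}"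
      proof -
        have "v \<notin> set (N u)" if "u \<in> set r" "v \<in> set q" for u v
          using NE[of u v] that rV nadj by (auto simp: non_adjacent_def)
        then show ?thesis using nadj by (auto simp: non_adjacent_def simp flip: p)
      qed
      have "\<not> confined N ?B ys 100 xs []"
      proof
        assume "confined N ?B ys 100 xs []"
        then obtain D where D: "set xs \<subseteq> set ?B \<union> D" "\<And>u. u \<in> D \<Longrightarrow> u \<notin> set ys"
          "\<And>u. u \<in> D \<Longrightarrow> set (N u) \<subseteq> set ?B \<union> D"
          using confined_closure[of N ?B ys 100 xs "[]"] by auto
        have "hd q \<in> D" using D(1) q(2) hd_in_set[OF q'(1)] avoid by blast
        then have "set q \<subseteq> D"
          using path_in_closed_set[OF q'(2), of "\<lambda>u. set (N u)" D "set ?B"] N D(3) q'(1) avoid by blast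
        then show False using D(2) q(3) last_in_set[OF q'(1)] by blast
      qed
      then have hd: "hd p \<notin> set ys"
        and rest: "no_pair N xs ys n (map (\<lambda>w. w # p) (filter (\<lambda>w. w \<notin> set p) (N (hd p))) @ ps')"
        using Suc.prems(1) ps by (auto simp del: no_pair.simps(1,2))
      have hd_p: "hd p = last r" using p by (simp add: hd_rev flip: p)
      \<comment> \<open>\<open>r @ t\<close> ends in \<open>ys\<close> while \<open>r\<close> does
        not.\<close>
      then have "t \<noteq> []" using hd Suc.prems(3,5) by auto
      then obtain w t' where t: "t = w # t'" by (cases t) auto
      have "{last r, w} \<in> E" using Suc.prems(3,4) t by (auto simp: is_path_def path_edges_append)
      then have "w \<in> set (N (hd p))" using N hd_p by simp
      moreover have "w \<notin> set p" using Suc.prems(4) t by (auto simp: is_path_def simp flip: p)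
      ultimately have "rev (r @ [w]) \<in> set (map (\<lambda>w. w # p) (filter (\<lambda>w. w \<notin> set p) (N (hd p))) @ ps')"
        using p by auto
      then have "\<not> non_adjacent E ((r @ [w]) @ t') q"
        by (rule Suc.IH[OF rest]) (use Suc.prems(4,5) t in auto)
      then show False using nadj t by simp
    qed
  qed
qed

text \<open>The search treats paths from \<open>xs\<close> to \<open>ys\<close>. Reversal settles
  the others, as non-adjacency depends on the vertex sets alone.\<close>

lemma no_non_adjacent_XY_paths:
  assumes N: "\<And>u w. {u, w} \<in> E \<longleftrightarrow> u \<in> V \<and> w \<in> set (N u)"
    and chk: "no_pair N xs ys n (map (\<lambda>x. [x]) xs)"
  shows "\<not> (\<exists>p q. XY_path V E (set xs) (set ys) p \<and> XY_path V E (set xs) (set ys) q \<and> non_adjacent E p q)"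
proof
  assume "\<exists>p q. XY_path V E (set xs) (set ys) p \<and> XY_path V E (set xs) (set ys) q \<and> non_adjacent E p q"
  then obtain p q where pq: "XY_path V E (set xs) (set ys) p" "XY_path V E (set xs) (set ys) q" "non_adjacent E p q"
    by blast
  have orient: "\<exists>r'. is_path V E r' \<and> hd r' \<in> set xs \<and> last r' \<in> set ys \<and> set r' = set r"
    if "XY_path V E (set xs) (set ys) r" for r
  proof (cases "hd r \<in> set xs \<and> last r \<in> set ys")
    case True
    then show ?thesis using that by (auto simp: XY_path_def)
  next
    case False
    then have "is_path V E (rev r)" "hd (rev r) \<in> set xs" "last (rev r) \<in> set ys"
      using that by (auto simp: XY_path_def is_path_def hd_rev last_rev)
    then show ?thesis by (metis set_rev)
  qed
  obtain p' where p': "is_path V E p'" "hd p' \<in> set xs" "last p' \<in> set ys" "set p' = set p"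
    using orient[OF pq(1)] by blast
  obtain q' where q': "is_path V E q'" "hd q' \<in> set xs" "last q' \<in> set ys" "set q' = set q"
    using orient[OF pq(2)] by blast
  have "p' \<noteq> []" using p'(1) by (simp add: is_path_def)
  then have eq: "[hd p'] @ tl p' = p'" by simp
  have "rev [hd p'] \<in> set (map (\<lambda>x. [x]) xs)" using p'(2) by simp
  note start = no_pair_sound[OF _ _ q'(1-3) chk this]
  have "w \<in> set (N u)" if "{u, w} \<in> E" for u w using N that by blast
  moreover have "{u, w} \<in> E" if "u \<in> V" "w \<in> set (N u)" for u w using N that by blast
  ultimately have "\<not> non_adjacent E ([hd p'] @ tl p') q'"
    by (rule start) (use p' eq in auto)
  then have "\<not> non_adjacent E p' q'" by (simp only: eq not_False_eq_True)
  then show False using pq(3) p'(4) q'(4) by (simp add: non_adjacent_def)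
qed

section \<open>The Petersen graph and the graph of rungs\<close>

definition petersen_nbrs :: "nat list list" where
  "petersen_nbrs = [[1,4,5], [0,2,6], [1,3,7], [2,4,8], [3,0,9],
     [7,8,0], [8,9,1], [9,5,2], [5,6,3], [6,7,4]]"

text \<open>Vertices are numbered in the order of the rungs, so the chords are the pairs \<open>{2 k, 2 k + 1}\<close>.\<close>
definition ladder_lines :: "nat list list" where
  "ladder_lines = [[0,4,6,10,16,18,22,28], [1,8,11,12,20,23,26,30],
     [2,5,9,14,17,21,24,31], [3,7,13,15,19,25,27,29]]"

definition ladder_nbrs :: "nat list list" where
  "ladder_nbrs = [[1,4], [0,8], [3,5], [2,7], [0,5,6], [2,4,9], [4,7,10], [3,6,13], [1,9,11],
     [5,8,14], [6,11,16], [8,10,12], [11,13,20], [7,12,15], [9,15,17], [13,14,19], [10,17,18],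
     [14,16,21], [16,19,22], [15,18,25], [12,21,23], [17,20,24], [18,23,28], [20,22,26],
     [21,25,31], [19,24,27], [23,27,30], [25,26,29], [22,29], [27,28], [26,31], [24,30]]"

definition nbr_edges :: "nat list list \<Rightarrow> nat set set" where
  "nbr_edges ns = {{u, w} | u w. u < length ns \<and> w \<in> set (ns ! u)}"

text \<open>The condition requires neighbour lists that are symmetric, loopless and in range;
  symmetry makes every edge visible from both ends.\<close>

lemma nbr_edges_iff:
  assumes "list_all (\<lambda>u. list_all (\<lambda>w. w < length ns \<and> w \<noteq> u \<and> u \<in> set (ns ! w)) (ns ! u)) [0..<length ns]"
  shows "{u, w} \<in> nbr_edges ns \<longleftrightarrow> u \<in> {..<length ns} \<and> w \<in> set (ns ! u)"
    and "fin_graph {..<length ns} (nbr_edges ns)"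
proof -
  have *: "w < length ns \<and> w \<noteq> u \<and> u \<in> set (ns ! w)" if "u < length ns" "w \<in> set (ns ! u)" for u w
  proof -
    have "u \<in> set [0..<length ns]" using that(1) by simp
    then show ?thesis using assms that(2) unfolding list_all_iff by blast
  qed
  show "{u, w} \<in> nbr_edges ns \<longleftrightarrow> u \<in> {..<length ns} \<and> w \<in> set (ns ! u)"
  proof
    assume "{u, w} \<in> nbr_edges ns"
    then obtain a b where ab: "{u, w} = {a, b}" "a < length ns" "b \<in> set (ns ! a)"
      unfolding nbr_edges_def by blast
    then have "u = a \<and> w = b \<or> u = b \<and> w = a" by (simp add: doubleton_eq_iff)
    then show "u \<in> {..<length ns} \<and> w \<in> set (ns ! u)" using ab(2,3) *[OF ab(2,3)] by auto
  qed (auto simp: nbr_edges_def)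
  have "e \<subseteq> {..<length ns} \<and> card e = 2" if "e \<in> nbr_edges ns" for e
  proof -
    obtain a b where "e = {a, b}" "a < length ns" "b \<in> set (ns ! a)"
      using \<open>e \<in> nbr_edges ns\<close> unfolding nbr_edges_def by blast
    then show ?thesis using *[of a b] by auto
  qed
  then show "fin_graph {..<length ns} (nbr_edges ns)" by (simp add: fin_graph_def)
qed

lemma symmetric_nbrs:
  "list_all (\<lambda>u. list_all (\<lambda>w. w < length ladder_nbrs \<and> w \<noteq> u \<and> u \<in> set (ladder_nbrs ! w)) (ladder_nbrs ! u))
     [0..<length ladder_nbrs]"
  "list_all (\<lambda>u. list_all (\<lambda>w. w < length petersen_nbrs \<and> w \<noteq> u \<and> u \<in> set (petersen_nbrs ! w)) (petersen_nbrs ! u))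
     [0..<length petersen_nbrs]"
  by code_simp+

text \<open>The spokes join \<open>i\<close> to \<open>i + 5\<close>. Two indices differ by 1 or 2
  modulo 5, so any two spokes are joined by an edge of the outer or the inner cycle.\<close>

lemma no_pair_petersen:
  "no_pair (nth petersen_nbrs) [0, 1, 2, 3, 4] [5, 6, 7, 8, 9] 100 (map (\<lambda>x. [x]) [0, 1, 2, 3, 4])"
  by code_simp

lemma no_pair_ladder:
  "no_pair (nth ladder_nbrs) [0, 1, 2, 3] [28, 30, 31, 29] 300 (map (\<lambda>x. [x]) [0, 1, 2, 3])"
  by code_simp

lemma zip_tl_in_path_edges: "(u, w) \<in> set (zip p (tl p)) \<Longrightarrow> {u, w} \<in> path_edges p"
proof (induction p)
  case (Cons x p)
  then show ?case by (cases p) auto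
qed simp

text \<open>\<open>zip p (tl p)\<close> lists the consecutive pairs of \<open>p\<close> and so
  serves as an executable form of \<open>path_edges\<close>. Edges off the four lines stay within a
  pair with equal halves.\<close>

lemma ladder_edges:
  "list_all (\<lambda>u. list_all (\<lambda>w. u div 2 = w div 2 \<or>
     list_ex (\<lambda>p. (u, w) \<in> set (zip p (tl p)) \<or> (w, u) \<in> set (zip p (tl p))) ladder_lines)
     (ladder_nbrs ! u)) [0..<length ladder_nbrs]"
  by code_simp

lemma four_paths_do_not_suffice:
  "\<exists>(V :: nat set) E X Y \<P>. fin_graph V E \<and> X \<subseteq> V \<and> Y \<subseteq> V \<and> disjoint_XY_paths V E X Y 4 \<P> \<and>
     (\<forall>v \<in> paths_verts \<P>. card {e \<in> E - paths_edges \<P>. v \<in> e} \<le> 1) \<and>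
     \<not> (\<exists>p q. XY_path V E X Y p \<and> XY_path V E X Y q \<and> non_adjacent E p q)"
proof -
  let ?n = "length ladder_nbrs"
  \<comment> \<open>\<open>?X\<close> and \<open>?Y\<close> hold the first and the last vertices of
    the lines, in the order of \<open>ladder_lines\<close>.\<close>
  let ?V = "{..<?n}" and ?E = "nbr_edges ladder_nbrs" and ?X = "[0, 1, 2, 3] :: nat list"
    and ?Y = "[28, 30, 31, 29] :: nat list" and ?P = "set ladder_lines"
  note E = nbr_edges_iff[OF symmetric_nbrs(1)]
  have n: "?n = 32" by (simp add: ladder_nbrs_def)
  have "\<forall>p\<in>?P. p \<noteq> [] \<and> distinct p \<and> set p \<subseteq> {..<32} \<and> hd p \<in> set ?X \<and> last p \<in> set ?Y"
    by (simp add: ladder_lines_def)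
  moreover have "\<forall>p\<in>?P. path_edges p \<subseteq> ?E"
    unfolding ladder_lines_def by (simp add: E) (simp add: ladder_nbrs_def)
  ultimately have "\<forall>p\<in>?P. XY_path ?V ?E (set ?X) (set ?Y) p"
    by (simp add: XY_path_def is_path_def n)
  moreover have "card ?P = 4" by (simp add: ladder_lines_def)
  moreover have "\<forall>p\<in>?P. \<forall>q\<in>?P. p \<noteq> q \<longrightarrow> set p \<inter> set q = {}" by (simp add: ladder_lines_def)
  ultimately have "disjoint_XY_paths ?V ?E (set ?X) (set ?Y) 4 ?P"
    by (simp add: disjoint_XY_paths_def)
  moreover have "card {e \<in> ?E - paths_edges ?P. v \<in> e} \<le> 1" for v
  proof -
    \<comment> \<open>By \<open>ladder_edges\<close>, an edge at \<open>v\<close> off the lines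
      joins the two numbers with the same half as \<open>v\<close>, which leaves one
      candidate.\<close>
    have "{e \<in> ?E - paths_edges ?P. v \<in> e} \<subseteq> {{2 * (v div 2), 2 * (v div 2) + 1}}" (is "?S \<subseteq> {?e}")
    proof
      fix e assume "e \<in> ?S"
      then obtain u w where e: "e = {u, w}" "u < ?n" "w \<in> set (ladder_nbrs ! u)"
        and v: "v = u \<or> v = w" and no: "{u, w} \<notin> paths_edges ?P"
        by (auto simp: nbr_edges_def)
      have "(u, w) \<notin> set (zip p (tl p))" "(w, u) \<notin> set (zip p (tl p))" if "p \<in> ?P" for p
        using no that zip_tl_in_path_edges[of u w p] zip_tl_in_path_edges[of w u p]
        by (auto simp: paths_edges_def insert_commute)
      moreover have u: "u \<in> set [0..<?n]" using e(2) by simp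
      ultimately have eq: "u div 2 = w div 2" using ladder_edges e(3) unfolding list_all_iff list_ex_iff by blast
      have "u \<noteq> w" using symmetric_nbrs(1) u e(3) unfolding list_all_iff by blast
      then have "u mod 2 \<noteq> w mod 2" using eq by (metis mult_div_mod_eq)
      then have "u mod 2 = 0 \<and> w mod 2 = 1 \<or> u mod 2 = 1 \<and> w mod 2 = 0" by (metis not_mod_2_eq_0_eq_1)
      moreover have "v div 2 = u div 2" using v eq by auto
      then have "u = 2 * (v div 2) + u mod 2" "w = 2 * (v div 2) + w mod 2"
        using eq mult_div_mod_eq[of 2 u] mult_div_mod_eq[of 2 w] by simp_all
      ultimately have "u = 2 * (v div 2) \<and> w = 2 * (v div 2) + 1 \<or> w = 2 * (v div 2) \<and> u = 2 * (v div 2) + 1"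
        by (metis add_0_right)
      then show "e \<in> {?e}" using e(1) by auto
    qed
    then have "card ?S \<le> card {?e}" by (rule card_mono[rotated]) simp
    then show ?thesis by simp
  qed
  moreover have "set ?X \<subseteq> ?V" "set ?Y \<subseteq> ?V" by (simp_all add: n)
  moreover note E(2) no_non_adjacent_XY_paths[OF E(1) no_pair_ladder]
  ultimately show ?thesis by blast
qed

lemma max_degree_three_does_not_suffice:
  "\<exists>(V :: nat set) E X Y \<P>. fin_graph V E \<and> max_degree V E = 3 \<and> X \<subseteq> V \<and> Y \<subseteq> V \<and>
     disjoint_XY_paths V E X Y 5 \<P> \<and>
     \<not> (\<exists>p q. XY_path V E X Y p \<and> XY_path V E X Y q \<and> non_adjacent E p q)"
proof -
  let ?n = "length petersen_nbrs"
  let ?V = "{..<?n}" and ?E = "nbr_edges petersen_nbrs" and ?X = "[0, 1, 2, 3, 4] :: nat list"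
    and ?Y = "[5, 6, 7, 8, 9] :: nat list" and ?P = "set [[0, 5], [1, 6], [2, 7], [3, 8], [4, 9 :: nat]]"
  note E = nbr_edges_iff[OF symmetric_nbrs(2)]
  have n: "?n = 10" by (simp add: petersen_nbrs_def)
  have "\<forall>p\<in>?P. path_edges p \<subseteq> ?E" by (simp add: E) (simp add: petersen_nbrs_def)
  then have "\<forall>p\<in>?P. XY_path ?V ?E (set ?X) (set ?Y) p"
    by (simp add: XY_path_def is_path_def n)
  then have "disjoint_XY_paths ?V ?E (set ?X) (set ?Y) 5 ?P"
    by (simp add: disjoint_XY_paths_def)
  moreover have "max_degree ?V ?E = 3"
  proof -
    have "degree ?E v = 3" if "v \<in> ?V" for v
    proof -
      \<comment> \<open>Edges at \<open>v\<close> correspond to entries of its neighbour list, whose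
        three members are counted by evaluation.\<close>
      have "{e \<in> ?E. v \<in> e} = (\<lambda>w. {v, w}) ` set (petersen_nbrs ! v)"
      proof
        show "{e \<in> ?E. v \<in> e} \<subseteq> (\<lambda>w. {v, w}) ` set (petersen_nbrs ! v)"
        proof
          fix e assume e: "e \<in> {e \<in> ?E. v \<in> e}"
          then obtain w where "e = {v, w}" unfolding nbr_edges_def by blast
          then show "e \<in> (\<lambda>w. {v, w}) ` set (petersen_nbrs ! v)" using e E(1)[of v w] by blast
        qed
        show "(\<lambda>w. {v, w}) ` set (petersen_nbrs ! v) \<subseteq> {e \<in> ?E. v \<in> e}" using that E(1) by blast
      qed
      moreover have "inj_on (\<lambda>w. {v, w}) (set (petersen_nbrs ! v))"
        by (auto simp: inj_on_def doubleton_eq_iff)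
      moreover have "list_all (\<lambda>v. card (set (petersen_nbrs ! v)) = 3) [0..<?n]" by code_simp
      ultimately show ?thesis using that by (simp add: degree_def card_image list_all_iff)
    qed
    then have "degree ?E ` ?V = (\<lambda>_. 3) ` ?V" by (rule image_cong[OF refl])
    then have "degree ?E ` ?V = {3}" by (simp add: n image_constant_conv lessThan_empty_iff)
    then show ?thesis by (simp add: max_degree_def)
  qed
  moreover have "set ?X \<subseteq> ?V" "set ?Y \<subseteq> ?V" by (simp_all add: n)
  moreover note E(2) no_non_adjacent_XY_paths[OF E(1) no_pair_petersen]
  ultimately show ?thesis by blast
qed

theorem theorem1p8:
  shows "(\<forall>(V :: 'a set) E X Y \<P>.
            fin_graph V E \<longrightarrow> X \<subseteq> V \<longrightarrow> Y \<subseteq> V \<longrightarrow>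
            disjoint_XY_paths V E X Y 5 \<P> \<longrightarrow>
            (\<forall>v \<in> paths_verts \<P>. card {e \<in> E - paths_edges \<P>. v \<in> e} \<le> 1) \<longrightarrow>
            (\<exists>p q. XY_path V E X Y p \<and> XY_path V E X Y q \<and> non_adjacent E p q))
       \<and> (\<exists>(V :: nat set) E X Y \<P>.
            fin_graph V E \<and> X \<subseteq> V \<and> Y \<subseteq> V \<and>
            disjoint_XY_paths V E X Y 4 \<P> \<and>
            (\<forall>v \<in> paths_verts \<P>. card {e \<in> E - paths_edges \<P>. v \<in> e} \<le> 1) \<and>
            \<not> (\<exists>p q. XY_path V E X Y p \<and> XY_path V E X Y q \<and> non_adjacent E p q))
       \<and> (\<exists>(V :: nat set) E X Y \<P>.
            fin_graph V E \<and> max_degree V E = 3 \<and> X \<subseteq> V \<and> Y \<subseteq> V \<and>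
            disjoint_XY_paths V E X Y 5 \<P> \<and>
            \<not> (\<exists>p q. XY_path V E X Y p \<and> XY_path V E X Y q \<and> non_adjacent E p q))"
  by (intro conjI allI impI four_paths_do_not_suffice max_degree_three_does_not_suffice)
    (rule ex_non_adjacent_XY_paths)

end
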